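(* Let $m(t),n(t)\colon\mathbb{Z}_{>0}\to\mathbb{Z}_{>0}$ be functions satisfying $n(t)\to\infty$ as $t\to\infty$ and $m=o(n)$ (i.e. $m(t)/n(t)\to0$). Then, as $t\to\infty$, $$\log|\mathcal{D}_n^m|=(1+o(1))\log\binom{mn}{n},$$ where $m=m(t)$ and $n=n(t)$.
   Context: For a polynomial $P\in\mathbb{C}[x]$ of degree exactly $n$ and an $m$-tuple $\Lambda=(\lambda_1,\ldots,\lambda_m)$ of distinct complex numbers, the dope matrix $D_P(\Lambda)$ is the $m\times(n+1)$ matrix $(c_{ij})$, with $i\in\{1,\ldots,m\}$ and $j\in\{0,1,\ldots,n\}$, where $c_{ij}=1$ if $P^{(j)}(\lambda_i)=0$ and $c_{ij}=0$ otherwise. $\mathcal{D}_n^m$ denotes the set of all $m\times(n+1)$ dope matrices, i.e. all matrices $D_P(\Lambda)$ with $\deg P=n$ and $\Lambda$ any $m$-tuple of distinct complex numbers. The notation $o(1)$ denotes a function of $t$ tending to $0$ as $t\to\infty$.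
   Formalization: The formal theorem also assumes m(t) ≥ 2 for all large t; as printed the claim fails when m(t) = 1 infinitely often, since then log binom(mn,n) = 0 while |D_n^1| = 2^n, so log|D_n^1| = n log 2 > 0. *)

theory Defs
  imports
    Complex_Main
    "HOL-Library.Landau_Symbols"
    "HOL-Computational_Algebra.Polynomial"
    "Jordan_Normal_Form.Matrix"
begin

text \<open>
  An \<open>m\<close>-tuple is a list of length \<open>m\<close>. Rows are indexed from 0, so row \<open>i\<close> belongs to the
  \<open>(i+1)\<close>-st entry of the tuple; column \<open>j\<close> belongs to the \<open>j\<close>-th derivative.
\<close>

definition dope_matrix :: "complex poly \<Rightarrow> complex list \<Rightarrow> nat mat" where
  "dope_matrix P \<Lambda> = mat (length \<Lambda>) (degree P + 1)
     (\<lambda>(i, j). if poly ((pderiv ^^ j) P) (\<Lambda> ! i) = 0 then 1 else 0)"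

text \<open>
  The condition \<open>P \<noteq> 0\<close> only matters for \<open>n = 0\<close>, since the library puts \<open>degree 0 = 0\<close>.
\<close>

definition dope_matrices :: "nat \<Rightarrow> nat \<Rightarrow> nat mat set" where
  "dope_matrices m n =
     {dope_matrix P \<Lambda> | P \<Lambda>. P \<noteq> 0 \<and> degree P = n \<and> length \<Lambda> = m \<and> distinct \<Lambda>}"

end

theory Submission
  imports Defs "Jordan_Normal_Form.Determinant" "HOL-Library.Function_Algebras"
    "HOL-Real_Asymp.Real_Asymp"
begin

text \<open>
  A dope matrix records which of the conditions \<open>P\<^bsup>(j)\<^esup>(x\<^sub>i) = 0\<close>
  hold, so it is the same as a set \<open>Z\<close> of pairs \<open>(i, j)\<close>. For fixed nodes the
  conditions are linear in \<open>P\<close>, which lives in a space of dimension \<open>n + 1\<close>. A pattern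
  is therefore essentially determined by at most \<open>n\<close> independent conditions out of the \<open>m n\<close>
  conditions with \<open>j < n\<close>, and the count is \<open>mn choose n\<close> up to factors that are negligible
  after taking logarithms.

  Lower bound (\<open>card_patterns_lower\<close>). An \<open>n\<close>-set \<open>B\<close> of pairs that contains at most
  \<open>n - k\<close> pairs with \<open>j \<ge> k\<close>, for every \<open>k\<close>, is exactly the pattern of some polynomial
  (\<open>exists_pattern\<close>). By dimension some nonzero \<open>P\<close> satisfies the conditions in \<open>B\<close>.
  Adding any further condition \<open>f\<close> leaves a set that obeys the analogous bounds
  \<open>n + 1 - k\<close>, and for generic nodes such a set of \<open>n + 1\<close> conditions forces \<open>P = 0\<close>;
  hence \<open>P\<close> violates every condition outside \<open>B\<close>. Genericity is exploited one node at a
  time. The subspace cut out so far is described by the set of degrees of its nonzero elements, and the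
  conditions at a new generic node remove from it the degrees that a greedy matching picks
  (\<open>generic_node\<close>). This rests on the nonvanishing of a generalised Wronskian, whose top
  coefficient is a positive number because differentiating the determinant gives a sum of determinants of
  the same kind (\<open>det_jet_mat_top_coeff\<close>). A cycle-lemma argument shows that a
  fraction at least \<open>1/n\<close> of all \<open>n\<close>-sets has the required distribution.

  Upper bound (\<open>card_patterns_upper\<close>). Fix a maximal independent subset \<open>B\<close> of the
  pattern. For given \<open>B\<close>, adjoining generic evaluation functionals turns membership of \<open>f\<close> in
  the pattern into the vanishing of one determinant, which is a polynomial in the \<open>m\<close> nodes of
  degree polynomial in \<open>n\<close>. Zero patterns of such a family are counted by linear independence of
  products of its members (\<open>card_zero_patterns_le\<close>), which bounds their number by the
  number of monomials, \<open>n\<^bsup>O(m)\<^esup>\<close>. Since \<open>m = o(n)\<close> and \<open>m \<ge> 2\<close> eventually, the logarithm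
  \<open>m ln n\<close> of this factor is \<open>o(n ln m)\<close>, while
  \<open>ln (mn choose n) \<ge> n ln m\<close> (\<open>entropy_ratio_bound\<close>).
\<close>

hide_const (open) module.smult

section \<open>Linear functionals and degree sets\<close>

interpretation poly_space: vector_space "smult :: complex \<Rightarrow> complex poly \<Rightarrow> complex poly"
  by unfold_locales (auto simp: smult_add_right smult_add_left)

abbreviation functional :: "(complex poly \<Rightarrow> complex) \<Rightarrow> bool" where
  "functional \<equiv> module_hom smult (*)"

lemma functionalI:
  assumes "\<And>p q. \<phi> (p + q) = \<phi> p + \<phi> q" "\<And>c p. \<phi> (smult c p) = c * \<phi> p"
  shows "functional \<phi>"
  using assms by unfold_locales (auto simp: algebra_simps)

lemma functionalD:
  assumes "functional \<phi>"
  shows "\<phi> (p + q) = \<phi> p + \<phi> q" "\<phi> (smult c p) = c * \<phi> p" "\<phi> 0 = 0"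
    "\<phi> (p - q) = \<phi> p - \<phi> q" "\<phi> (sum f I) = (\<Sum>i\<in>I. \<phi> (f i))"
  using module_hom.add[OF assms] module_hom.scale[OF assms] module_hom.zero[OF assms]
    module_hom.diff[OF assms] module_hom.sum[OF assms] by auto

definition dval :: "nat \<Rightarrow> complex \<Rightarrow> complex poly \<Rightarrow> complex" where
  "dval j x p = poly ((pderiv ^^ j) p) x"

lemma functional_dval: "functional (dval j x)"
  by (rule functionalI) (simp_all add: dval_def higher_pderiv_add higher_pderiv_smult)

lemma functional_poly: "functional (\<lambda>p. poly p x)"
  by (rule functionalI) simp_all

lemma subspace_kernel:
  assumes "poly_space.subspace V" "\<And>i. i \<in> I \<Longrightarrow> functional (\<phi> i)"
  shows "poly_space.subspace {p \<in> V. \<forall>i\<in>I. \<phi> i p = 0}"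
  using assms by (auto simp: poly_space.subspace_def functionalD)

lemma subspace_degree_le: "poly_space.subspace {p. degree p \<le> n}"
  by (auto simp: poly_space.subspace_def intro: degree_add_le order_trans[OF degree_smult_le])

text \<open>
  The degrees that occur in \<open>V\<close> are the pivots of an echelon basis, so their number is
  \<open>dim V\<close>. Unlike a basis, the set of pivots can be tracked explicitly when conditions are
  imposed.
\<close>

definition degs :: "complex poly set \<Rightarrow> nat set" where
  "degs V = degree ` (V - {0})"

lemma degs_mono: "V \<subseteq> W \<Longrightarrow> degs V \<subseteq> degs W"
  by (auto simp: degs_def)

lemma degsE:
  assumes "e \<in> degs V"
  obtains p where "p \<in> V" "p \<noteq> 0" "degree p = e"
  using assms by (auto simp: degs_def)

lemma degs_degree_le: "degs {p. degree p \<le> n} = {..n}"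
proof -
  have "e \<in> degs {p. degree p \<le> n}" if "e \<le> n" for e
    unfolding degs_def using that
    by (intro image_eqI[of _ _ "monom 1 e"]) (auto simp: degree_monom_eq)
  then show ?thesis by (auto simp: degs_def)
qed

lemma degs_empty_iff: "poly_space.subspace V \<Longrightarrow> degs V = {} \<longleftrightarrow> V = {0}"
  by (auto simp: degs_def poly_space.subspace_0)

lemma degree_reduce:
  fixes p q :: "complex poly"
  assumes "degree p = degree q" "p \<noteq> 0" "q \<noteq> 0"
  obtains c where "p - smult c q = 0 \<or> degree (p - smult c q) < degree p"
proof -
  let ?c = "lead_coeff p / lead_coeff q"
  let ?r = "p - smult ?c q"
  have "coeff ?r (degree p) = 0" using assms by auto
  moreover have "degree ?r \<le> degree p"
    using assms(1) by (intro degree_diff_le order_trans[OF degree_smult_le]) auto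
  ultimately have "?r = 0 \<or> degree ?r < degree p"
    using leading_coeff_0_iff[of ?r] by (cases "degree ?r = degree p") auto
  then show ?thesis using that by blast
qed

text \<open>
  One element per degree gives an echelon basis: leading terms are cancelled from the top.
\<close>

lemma degs_spanning:
  assumes V: "poly_space.subspace V" and E: "degs V \<subseteq> E" "finite E"
    and q: "\<And>e. e \<in> degs V \<Longrightarrow> q e \<in> V \<and> q e \<noteq> 0 \<and> degree (q e) = e"
    and p: "p \<in> V"
  shows "\<exists>a. p = (\<Sum>e\<in>E. smult (a e) (q e))"
  using p
proof (induction "degree p" arbitrary: p rule: less_induct)
  case less
  show ?case
  proof (cases "p = 0")
    case True
    then show ?thesis by (intro exI[of _ "\<lambda>_. 0"]) simp
  next
    case False
    define d where "d = degree p"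
    have d: "d \<in> degs V" using less.prems False by (auto simp: degs_def d_def)
    obtain c where c: "p - smult c (q d) = 0 \<or> degree (p - smult c (q d)) < degree p"
      using degree_reduce[of p "q d"] q[OF d] False by (auto simp: d_def)
    have "\<exists>a. p - smult c (q d) = (\<Sum>e\<in>E. smult (a e) (q e))"
    proof (cases "p - smult c (q d) = 0")
      case True
      show ?thesis unfolding True by (rule exI[of _ "\<lambda>_. 0"]) simp
    next
      case False
      then show ?thesis
        using c less.hyps[of "p - smult c (q d)"] less.prems q[OF d] V
        by (simp add: poly_space.subspace_diff poly_space.subspace_scale)
    qed
    then obtain a where a: "p - smult c (q d) = (\<Sum>e\<in>E. smult (a e) (q e))" by blast
    have "p = (\<Sum>e\<in>E. smult (a e + (if e = d then c else 0)) (q e))"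
    proof -
      have "(\<Sum>e\<in>E. smult (a e + (if e = d then c else 0)) (q e))
          = (\<Sum>e\<in>E. smult (a e) (q e)) + (\<Sum>e\<in>E. if e = d then smult c (q e) else 0)"
        by (subst sum.distrib[symmetric], rule sum.cong) (auto simp: smult_add_left)
      also have "(\<Sum>e\<in>E. if e = d then smult c (q e) else 0) = smult c (q d)"
        using d E by (auto simp: sum.delta)
      also have "(\<Sum>e\<in>E. smult (a e) (q e)) = p - smult c (q d)" using a by simp
      finally show ?thesis by simp
    qed
    then show ?thesis by (intro exI[of _ "\<lambda>e. a e + (if e = d then c else 0)"])
  qed
qed

text \<open>
  A subspace with the same pivots as a larger one is the whole space, again by cancelling leading
  terms.
\<close>

lemma degs_inj:
  assumes V: "poly_space.subspace V" and W: "poly_space.subspace W"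
    and sub: "V \<subseteq> W" and d: "degs W \<subseteq> degs V"
  shows "V = W"
proof -
  have "p \<in> V" if "p \<in> W" for p
    using that
  proof (induction "degree p" arbitrary: p rule: less_induct)
    case less
    show ?case
    proof (cases "p = 0")
      case True then show ?thesis using V by (simp add: poly_space.subspace_0)
    next
      case False
      then have "degree p \<in> degs V" using less.prems d by (auto simp: degs_def)
      then obtain q where q: "q \<in> V" "q \<noteq> 0" "degree q = degree p" by (rule degsE)
      obtain c where c: "p - smult c q = 0 \<or> degree (p - smult c q) < degree p"
        using degree_reduce[of p q] q False by auto
      have "p - smult c q \<in> W"
        using less.prems q sub W by (auto intro!: poly_space.subspace_diff poly_space.subspace_scale)
      then have "p - smult c q \<in> V"
        using c less.hyps[of "p - smult c q"] poly_space.subspace_0[OF V] by (cases "p - smult c q = 0") auto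
      then have "p - smult c q + smult c q \<in> V"
        using V q by (intro poly_space.subspace_add poly_space.subspace_scale)
      then show ?thesis by simp
    qed
  qed
  then show ?thesis using sub by blast
qed

lemma card_degs_psubset:
  assumes "poly_space.subspace V" "poly_space.subspace W" "V \<subset> W" "finite (degs W)"
  shows "card (degs V) < card (degs W)"
proof (rule psubset_card_mono[OF assms(4)])
  show "degs V \<subset> degs W"
    using degs_inj[OF assms(1,2)] degs_mono[of V W] assms(3) by blast
qed

text \<open>
  A hyperplane has codimension one: if two degrees disappeared, the element of larger degree could be
  corrected by a multiple of the other one to lie in the kernel.
\<close>

lemma degs_kernel_one:
  assumes V: "poly_space.subspace V" and f: "functional \<phi>"
  shows "\<exists>d. degs V \<subseteq> insert d (degs {p \<in> V. \<phi> p = 0})"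
proof -
  have eq: "d = d'" if dd: "d \<in> degs V - degs {p \<in> V. \<phi> p = 0}"
      "d' \<in> degs V - degs {p \<in> V. \<phi> p = 0}" "d \<le> d'" for d d'
  proof (rule ccontr)
    assume "d \<noteq> d'"
    with that have lt: "d < d'" by simp
    obtain p where p: "p \<in> V" "p \<noteq> 0" "degree p = d" using dd(1) by (auto simp: degs_def)
    obtain q where q: "q \<in> V" "q \<noteq> 0" "degree q = d'" using dd(2) by (auto simp: degs_def)
    have "\<phi> p \<noteq> 0" using p that by (auto simp: degs_def)
    define r where "r = q - smult (\<phi> q / \<phi> p) p"
    have "\<phi> r = 0" using \<open>\<phi> p \<noteq> 0\<close> by (simp add: r_def functionalD[OF f])
    moreover have "r \<in> V" using p q V unfolding r_def
      by (intro poly_space.subspace_diff poly_space.subspace_scale)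
    moreover have dr: "degree r = d'"
      unfolding r_def diff_conv_add_uminus smult_minus_left[symmetric] using lt p q
      by (subst degree_add_eq_left) (auto intro: le_less_trans[OF degree_smult_le])
    moreover have "r \<noteq> 0" using dr lt by auto
    ultimately have "d' \<in> degs {p \<in> V. \<phi> p = 0}" by (auto simp: degs_def)
    then show False using that by auto
  qed
  have "d = d'" if "d \<in> degs V - degs {p \<in> V. \<phi> p = 0}" "d' \<in> degs V - degs {p \<in> V. \<phi> p = 0}"
    for d d' using eq[of d d'] eq[of d' d] that by linarith
  then show ?thesis by blast
qed

lemma card_degs_kernel:
  assumes V: "poly_space.subspace V" and fin: "finite (degs V)" and I: "finite I"
    and f: "\<And>i. i \<in> I \<Longrightarrow> functional (\<phi> i)"
  shows "card (degs V) \<le> card (degs {p \<in> V. \<forall>i\<in>I. \<phi> i p = 0}) + card I"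
  using I f
proof (induction I)
  case empty
  then show ?case by simp
next
  case (insert i I)
  define W where "W = {p \<in> V. \<forall>i\<in>I. \<phi> i p = 0}"
  have W: "poly_space.subspace W" unfolding W_def using V insert.prems by (intro subspace_kernel) auto
  obtain d where d: "degs W \<subseteq> insert d (degs {p \<in> W. \<phi> i p = 0})"
    using degs_kernel_one[OF W, of "\<phi> i"] insert.prems by auto
  have eq: "{p \<in> W. \<phi> i p = 0} = {p \<in> V. \<forall>i\<in>insert i I. \<phi> i p = 0}" by (auto simp: W_def)
  have "finite (degs {p \<in> W. \<phi> i p = 0})"
    using finite_subset[OF degs_mono[of "{p \<in> W. \<phi> i p = 0}" V] fin] by (auto simp: W_def)
  then have "card (degs W) \<le> card (degs {p \<in> W. \<phi> i p = 0}) + 1"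
    using card_mono[OF _ d] by (simp add: card_insert_if split: if_splits)
  moreover have "card (degs V) \<le> card (degs W) + card I"
    unfolding W_def using insert by auto
  ultimately show ?case using insert.hyps eq by simp
qed

section \<open>Generalised Wronskian determinants\<close>

text \<open>
  For \<open>j r = r\<close> this is the Wronskian matrix of \<open>p 0, \<dots>, p (c - 1)\<close>.
\<close>

definition jet_mat :: "nat \<Rightarrow> (nat \<Rightarrow> complex poly) \<Rightarrow> (nat \<Rightarrow> nat) \<Rightarrow> complex poly mat" where
  "jet_mat c p j = mat c c (\<lambda>(r, s). (pderiv ^^ j r) (p s))"

lemma jet_mat_carrier [simp]: "jet_mat c p j \<in> carrier_mat c c"
  by (simp add: jet_mat_def)

lemma det_jet_mat:
  "det (jet_mat c p j) =
    (\<Sum>\<sigma> | \<sigma> permutes {0..<c}. signof \<sigma> * (\<Prod>r = 0..<c. (pderiv ^^ j r) (p (\<sigma> r))))"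
  unfolding det_def'[OF jet_mat_carrier]
  by (intro sum.cong refl arg_cong2[of _ _ _ _ "(*)"] prod.cong)
     (auto simp: jet_mat_def dest: permutes_in_image)

lemma det_jet_mat_cong:
  assumes "\<And>r. r < c \<Longrightarrow> j r = j' r"
  shows "det (jet_mat c p j) = det (jet_mat c p j')"
  unfolding det_jet_mat using assms by (intro sum.cong refl arg_cong2[of _ _ _ _ "(*)"] prod.cong) auto

lemma pderiv_signof_mult: "pderiv (signof \<sigma> * (q :: complex poly)) = signof \<sigma> * pderiv q"
  by (cases "evenperm \<sigma>") (auto simp: sign_def pderiv_minus)

text \<open>
  The Leibniz rule differentiates one row at a time, and differentiating row \<open>k\<close> only raises the
  order \<open>j k\<close>. The family of these determinants is thus closed under differentiation up to sums,
  which makes induction possible.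
\<close>

lemma pderiv_det_jet_mat:
  "pderiv (det (jet_mat c p j)) = (\<Sum>k<c. det (jet_mat c p (j(k := Suc (j k)))))"
proof -
  have prod: "pderiv (\<Prod>r = 0..<c. (pderiv ^^ j r) (p (\<sigma> r)))
      = (\<Sum>k<c. \<Prod>r = 0..<c. (pderiv ^^ (j(k := Suc (j k))) r) (p (\<sigma> r)))" for \<sigma>
  proof -
    have "(\<Prod>r = 0..<c. (pderiv ^^ (j(k := Suc (j k))) r) (p (\<sigma> r)))
        = (\<Prod>r\<in>{0..<c} - {k}. (pderiv ^^ j r) (p (\<sigma> r))) * pderiv ((pderiv ^^ j k) (p (\<sigma> k)))"
      if "k < c" for k
      using that by (subst prod.remove[of _ k]) (auto intro!: prod.cong simp: mult.commute)
    then show ?thesis unfolding pderiv_prod atLeast0LessThan by (intro sum.cong) auto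
  qed
  show ?thesis
    unfolding det_jet_mat higher_pderiv_sum[of 1, simplified] pderiv_signof_mult prod sum_distrib_left
    by (rule sum.swap)
qed

lemma higher_pderiv_eq_0:
  fixes p :: "complex poly"
  assumes "degree p < j"
  shows "(pderiv ^^ j) p = 0"
  by (rule poly_eqI) (use assms in \<open>simp add: coeff_higher_pderiv coeff_eq_0\<close>)

text \<open>
  The rows from \<open>t\<close> on vanish in the columns up to \<open>t\<close>, and this block of zeros is too
  large for any permutation to avoid.
\<close>

lemma det_jet_mat_eq_0:
  assumes g: "\<And>a b. a < b \<Longrightarrow> b < c \<Longrightarrow> g a < g b"
    and p: "\<And>s. s < c \<Longrightarrow> degree (p s) = g s"
    and j: "\<And>a b. a < b \<Longrightarrow> b < c \<Longrightarrow> j a < j b"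
    and t: "t < c" "g t < j t"
  shows "det (jet_mat c p j) = 0"
  unfolding det_jet_mat
proof (rule sum.neutral, intro ballI)
  fix \<sigma> assume "\<sigma> \<in> {\<sigma>. \<sigma> permutes {0..<c}}"
  then have s: "\<sigma> permutes {0..<c}" by simp
  have "\<exists>r\<in>{t..<c}. \<sigma> r \<le> t"
  proof (rule ccontr)
    assume "\<not> ?thesis"
    then have "\<sigma> ` {t..<c} \<subseteq> {Suc t..<c}"
      using permutes_in_image[OF s] by (auto simp: not_le Suc_le_eq)
    then have "card {t..<c} \<le> card {Suc t..<c}"
      using permutes_inj_on[OF s] by (intro card_inj_on_le[of \<sigma>]) auto
    then show False using t by simp
  qed
  then obtain r where r: "t \<le> r" "r < c" "\<sigma> r \<le> t" by auto
  have "j t \<le> j r" using j[of t r] r by (cases "t = r") auto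
  moreover have "g (\<sigma> r) \<le> g t" using g[of "\<sigma> r" t] r t by (cases "\<sigma> r = t") auto
  ultimately have "degree (p (\<sigma> r)) < j r" using p[of "\<sigma> r"] r t by auto
  then have "(pderiv ^^ j r) (p (\<sigma> r)) = 0" by (rule higher_pderiv_eq_0)
  then have "(\<Prod>r = 0..<c. (pderiv ^^ j r) (p (\<sigma> r))) = 0"
    using r by (intro prod_zero) auto
  then show "signof \<sigma> * (\<Prod>r = 0..<c. (pderiv ^^ j r) (p (\<sigma> r))) = 0" by simp
qed

lemma det_jet_mat_diagonal:
  assumes g: "\<And>a b. a < b \<Longrightarrow> b < c \<Longrightarrow> g a < g b"
    and p: "\<And>s. s < c \<Longrightarrow> degree (p s) = g s \<and> lead_coeff (p s) = 1"
  shows "det (jet_mat c p g) = [:of_nat (\<Prod>s<c. fact (g s)):]"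
proof -
  have "upper_triangular (jet_mat c p g)"
    unfolding upper_triangular_def using g p
    by (auto simp: jet_mat_def intro!: higher_pderiv_eq_0)
  then have "det (jet_mat c p g) = (\<Prod>s<c. jet_mat c p g $$ (s, s))"
    by (subst det_upper_triangular[of _ c])
       (auto simp: prod_list_diag_prod jet_mat_def atLeast0LessThan)
  also have "\<dots> = (\<Prod>s<c. [:of_nat (fact (g s)):])"
  proof (rule prod.cong)
    fix s assume "s \<in> {..<c}"
    then have s: "s < c" by simp
    have d: "degree ((pderiv ^^ g s) (p s)) = 0" using p[OF s] by (simp add: degree_higher_pderiv)
    have "(pderiv ^^ g s) (p s) = [:coeff ((pderiv ^^ g s) (p s)) 0:]"
      by (rule degree_0_id[OF d, symmetric])
    also have "coeff ((pderiv ^^ g s) (p s)) 0 = of_nat (fact (g s))"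
      using conjunct2[OF p[OF s], unfolded conjunct1[OF p[OF s]]]
      by (simp add: coeff_higher_pderiv flip: pochhammer_fact)
    finally show "jet_mat c p g $$ (s, s) = [:of_nat (fact (g s)):]"
      using s by (simp add: jet_mat_def)
  qed simp
  also have "\<dots> = [:of_nat (\<Prod>s<c. fact (g s)):]"
    by (induction c) (auto simp: mult.commute)
  finally show ?thesis .
qed

text \<open>
  The heart of the lower bound. The candidate for the leading coefficient is positive when the orders
  are dominated by the degrees. Induction on the degree \<open>N\<close> of the determinant: the derivative is a sum of
  determinants of degree at most \<open>N - 1\<close>, each of which is zero (two equal rows, or an order exceeding its degree)
  or has a positive top coefficient. No cancellation can occur, and raising the last order that is
  still below its degree gives a nonzero summand.
\<close>

lemma det_jet_mat_top_coeff:
  assumes g: "\<And>a b. a < b \<Longrightarrow> b < c \<Longrightarrow> g a < g b"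
    and p: "\<And>s. s < c \<Longrightarrow> degree (p s) = g s \<and> lead_coeff (p s) = 1"
    and j: "\<And>a b. a < b \<Longrightarrow> b < c \<Longrightarrow> j a < j b" "\<And>r. r < c \<Longrightarrow> j r \<le> g r"
    and N: "(\<Sum>r<c. j r) + N = (\<Sum>r<c. g r)"
  shows "degree (det (jet_mat c p j)) \<le> N \<and>
    (\<exists>x::real. 0 < x \<and> coeff (det (jet_mat c p j)) N = of_real x)"
  using j N
proof (induction N arbitrary: j)
  case 0
  have "j r = g r" if "r < c" for r
  proof (rule ccontr)
    assume "j r \<noteq> g r"
    then have "(\<Sum>r<c. j r) < (\<Sum>r<c. g r)"
      using 0 that by (intro sum_strict_mono_ex1) (auto intro!: bexI[of _ r] le_neq_implies_less)
    then show False using 0 by simp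
  qed
  then have "det (jet_mat c p j) = det (jet_mat c p g)" by (intro det_jet_mat_cong) simp
  moreover have "(0::real) < of_nat (\<Prod>s<c. fact (g s))" by (simp add: prod_pos)
  ultimately show ?case
    by (auto simp: det_jet_mat_diagonal[OF g p] simp del: of_nat_prod
        intro!: exI[of _ "of_nat (\<Prod>s<c. fact (g s))"])
next
  case (Suc N)
  define F where "F = det (jet_mat c p j)"
  define T where "T k = det (jet_mat c p (j(k := Suc (j k))))" for k
  have pd: "pderiv F = (\<Sum>k<c. T k)" unfolding F_def T_def by (rule pderiv_det_jet_mat)
  have sumk: "(\<Sum>r<c. (j(k := Suc (j k))) r) + N = (\<Sum>r<c. g r)" if "k < c" for k
  proof -
    have "(\<Sum>r<c. (j(k := Suc (j k))) r) = (\<Sum>r<c. j r + (if r = k then 1 else 0))"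
      by (rule sum.cong) auto
    also have "\<dots> = (\<Sum>r<c. j r) + 1" using that by (simp add: sum.distrib)
    finally show ?thesis using Suc.prems by simp
  qed
  have good: "degree (T k) \<le> N \<and> (\<exists>x::real. 0 < x \<and> coeff (T k) N = of_real x)"
    if "k < c" "j k < g k" "\<And>b. k < b \<Longrightarrow> b < c \<Longrightarrow> Suc (j k) < j b" for k
    unfolding T_def
  proof (rule Suc.IH)
    show "(j(k := Suc (j k))) a < (j(k := Suc (j k))) b" if ab: "a < b" "b < c" for a b
      using Suc.prems(1)[OF ab] that(1,2) \<open>\<And>b. k < b \<Longrightarrow> b < c \<Longrightarrow> Suc (j k) < j b\<close>[of b] by auto
    show "(j(k := Suc (j k))) r \<le> g r" if "r < c" for r
      using Suc.prems(2)[OF that] \<open>j k < g k\<close> by auto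
  qed (use sumk[OF \<open>k < c\<close>] in auto)
  have all: "degree (T k) \<le> N \<and> (\<exists>x::real. 0 \<le> x \<and> coeff (T k) N = of_real x)" if k: "k < c" for k
  proof (cases "\<exists>b. k < b \<and> b < c \<and> j b \<le> Suc (j k)")
    case True
    then obtain b where b: "k < b" "b < c" "j b = Suc (j k)"
      using Suc.prems(1)[of k] by (meson Suc_leI le_antisym)
    have "T k = 0" unfolding T_def
      by (rule det_identical_rows[OF jet_mat_carrier, of k b])
         (use b in \<open>auto simp: jet_mat_def\<close>)
    then show ?thesis by (auto intro: exI[of _ 0])
  next
    case False
    then have strict: "\<And>b. k < b \<Longrightarrow> b < c \<Longrightarrow> Suc (j k) < j b" by (auto simp: not_le)
    show ?thesis
    proof (cases "j k < g k")
      case True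
      then show ?thesis using good[OF k True strict] by (auto intro: less_imp_le)
    next
      case False
      have "T k = 0" unfolding T_def
      proof (rule det_jet_mat_eq_0[OF g])
        show "degree (p s) = g s" if "s < c" for s using p[OF that] by simp
        show "(j(k := Suc (j k))) a < (j(k := Suc (j k))) b" if ab: "a < b" "b < c" for a b
          using Suc.prems(1)[OF ab] ab strict[of b] by auto
        show "g k < (j(k := Suc (j k))) k" using False by simp
      qed (use k in auto)
      then show ?thesis by (auto intro: exI[of _ 0])
    qed
  qed
  \<comment> \<open>Below its degree and last with this property, order \<open>k\<close> can be raised without meeting the next one.\<close>
  define k where "k = Max {r. r < c \<and> j r < g r}"
  have "\<exists>r<c. j r < g r"
  proof (rule ccontr)
    assume "\<not> ?thesis"
    then have "(\<Sum>r<c. g r) \<le> (\<Sum>r<c. j r)" by (intro sum_mono) (meson not_less lessThan_iff)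
    then show False using Suc.prems by simp
  qed
  then have "k \<in> {r. r < c \<and> j r < g r}" unfolding k_def by (intro Max_in) auto
  then have k: "k < c" "j k < g k" by auto
  have kb: "Suc (j k) < j b" if "k < b" "b < c" for b
  proof -
    have "b \<le> k" if "j b < g b" using that \<open>b < c\<close> unfolding k_def by (intro Max_ge) auto
    then have "\<not> j b < g b" using that by auto
    then show ?thesis using g[OF that] k by simp
  qed
  obtain x where x: "\<And>r. r < c \<Longrightarrow> 0 \<le> x r \<and> coeff (T r) N = complex_of_real (x r)"
    using that[of "\<lambda>r. SOME x. 0 \<le> x \<and> coeff (T r) N = complex_of_real x"]
      someI_ex[OF conjunct2[OF all]] by blast
  have xk: "0 < x k" using good[OF k kb] x[OF k(1)] by auto
  have "coeff (pderiv F) N = of_real (\<Sum>r<c. x r)"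
    unfolding pd coeff_sum of_real_sum by (intro sum.cong) (use x in auto)
  then have "of_nat (Suc N) * coeff F (Suc N) = of_real (\<Sum>r<c. x r)"
    by (simp add: coeff_pderiv)
  then have "coeff F (Suc N) = of_real ((\<Sum>r<c. x r) / of_nat (Suc N))"
    by (simp add: field_simps del: of_nat_Suc)
  moreover have "0 < (\<Sum>r<c. x r)"
    using xk x k by (intro sum_pos2[of _ k]) auto
  moreover have "degree (pderiv F) \<le> N" unfolding pd using all by (intro degree_sum_le) auto
  then have "degree F \<le> Suc N" by (simp add: degree_pderiv)
  ultimately show ?case unfolding F_def[symmetric]
    by (intro conjI exI[of _ "(\<Sum>r<c. x r) / of_nat (Suc N)"]) (auto simp del: of_nat_Suc)
qed

lemma finite_singular_jets:
  assumes g: "\<And>a b. a < b \<Longrightarrow> b < c \<Longrightarrow> g a < g b"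
    and p: "\<And>s. s < c \<Longrightarrow> degree (p s) = g s \<and> lead_coeff (p s) = 1"
    and j: "\<And>a b. a < b \<Longrightarrow> b < c \<Longrightarrow> j a < j b" "\<And>r. r < c \<Longrightarrow> j r \<le> g r"
  shows "finite {x. det (mat c c (\<lambda>(r, s). dval (j r) x (p s))) = 0}"
proof -
  obtain N where N: "(\<Sum>r<c. j r) + N = (\<Sum>r<c. g r)"
    using sum_mono[of "{..<c}" j g] j(2) by (auto simp: le_iff_add)
  have "det (jet_mat c p j) \<noteq> 0" using det_jet_mat_top_coeff[OF g p j N] by auto
  then have "finite {x. poly (det (jet_mat c p j)) x = 0}" by (rule poly_roots_finite)
  moreover have "poly (det (jet_mat c p j)) x = det (mat c c (\<lambda>(r, s). dval (j r) x (p s)))" for x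
  proof -
    have "poly (signof \<sigma>) x = signof \<sigma>" for \<sigma> :: "nat \<Rightarrow> nat" by auto
    then show ?thesis
    unfolding det_jet_mat poly_sum poly_mult poly_prod
    by (subst det_def'[of _ c])
       (auto simp: dval_def permutes_in_image intro!: sum.cong prod.cong dest: permutes_in_image)
  qed
  ultimately show ?thesis by simp
qed

section \<open>Degrees removed by a generic node\<close>

lemma det_mat_nonzero_solve:
  fixes f :: "nat \<Rightarrow> nat \<Rightarrow> complex"
  assumes "det (mat t t (\<lambda>(r, s). f r s)) \<noteq> 0"
  shows "\<exists>a. \<forall>r<t. (\<Sum>s<t. f r s * a s) = b r"
proof -
  let ?A = "mat t t (\<lambda>(r, s). f r s)"
  let ?b = "vec t (\<lambda>r. b r / det ?A)"
  have A: "?A \<in> carrier_mat t t" by simp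
  define v where "v = adj_mat ?A *\<^sub>v ?b"
  have v: "v \<in> carrier_vec t" unfolding v_def using adj_mat(1)[OF A] by simp
  have "?A *\<^sub>v v = (?A * adj_mat ?A) *\<^sub>v ?b"
    unfolding v_def using adj_mat(1)[OF A] by (intro assoc_mult_mat_vec[symmetric, OF A]) auto
  also have "\<dots> = det ?A \<cdot>\<^sub>v ?b"
    unfolding adj_mat(2)[OF A] by (intro eq_vecI) (auto simp: row_smult)
  finally have e: "?A *\<^sub>v v = det ?A \<cdot>\<^sub>v ?b" .
  have "(\<Sum>s<t. f r s * v $ s) = b r" if "r < t" for r
  proof -
    have "(?A *\<^sub>v v) $ r = (\<Sum>s<t. f r s * v $ s)"
      using that v by (auto simp: scalar_prod_def atLeast0LessThan intro!: sum.cong)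
    then show ?thesis using that assms e by simp
  qed
  then show ?thesis by blast
qed

lemma det_mat_eq_0_iff:
  fixes f :: "nat \<Rightarrow> nat \<Rightarrow> complex"
  shows "det (mat t t (\<lambda>(r, s). f r s)) = 0 \<longleftrightarrow>
    (\<exists>a. (\<exists>s<t. a s \<noteq> 0) \<and> (\<forall>r<t. (\<Sum>s<t. f r s * a s) = 0))"
proof -
  let ?A = "mat t t (\<lambda>(r, s). f r s)"
  have eq: "(?A *\<^sub>v v) $ r = (\<Sum>s<t. f r s * v $ s)" if "r < t" "v \<in> carrier_vec t" for v r
    using that by (auto simp: scalar_prod_def atLeast0LessThan intro!: sum.cong)
  show ?thesis
    unfolding det_0_iff_vec_prod_zero[of ?A t, simplified]
  proof safe
    fix v :: "complex vec" assume v: "v \<in> carrier_vec t" "v \<noteq> 0\<^sub>v t" "?A *\<^sub>v v = 0\<^sub>v t"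
    then have "\<exists>s<t. v $ s \<noteq> 0" by (auto simp: vec_eq_iff)
    moreover have "(\<Sum>s<t. f r s * v $ s) = 0" if "r < t" for r
      using eq[OF that v(1)] v(3) that by simp
    ultimately show "\<exists>a. (\<exists>s<t. a s \<noteq> 0) \<and> (\<forall>r<t. (\<Sum>s<t. f r s * a s) = 0)" by blast
  next
    fix a s assume a: "s < t" "a s \<noteq> 0" "\<forall>r<t. (\<Sum>s<t. f r s * a s) = 0"
    show "\<exists>v. v \<in> carrier_vec t \<and> v \<noteq> 0\<^sub>v t \<and> ?A *\<^sub>v v = 0\<^sub>v t"
    proof (intro exI[of _ "vec t a"] conjI)
      show "vec t a \<noteq> 0\<^sub>v t" using a by (auto simp: vec_eq_iff)
      show "?A *\<^sub>v vec t a = 0\<^sub>v t"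
        using a eq[of _ "vec t a"] by (intro eq_vecI) auto
    qed simp
  qed
qed

text \<open>
  Each order \<open>j\<close>, in increasing order, is matched to the smallest unused degree \<open>e \<ge> j\<close>.
  The function \<open>R\<close> counts the orders that later nodes will contribute; the last conjunct says that
  the Hall-type condition survives for them, so that the greedy choice can be repeated at the next node.
  The conjunct before it expresses minimality: a degree that was skipped in favour of a larger one was
  too small for the order in question.
\<close>

lemma greedy_transversal:
  fixes R :: "nat \<Rightarrow> nat"
  assumes "finite E" "sorted_wrt (<) js" and R: "\<And>k l. k \<le> l \<Longrightarrow> R l \<le> R k"
    and "\<And>k. card {j \<in> set js. k \<le> j} + R k \<le> card {e \<in> E. k \<le> e}"
  shows "\<exists>gs. length gs = length js \<and> sorted_wrt (<) gs \<and> set gs \<subseteq> E \<and>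
    (\<forall>s<length js. js ! s \<le> gs ! s) \<and>
    (\<forall>e\<in>E - set gs. \<forall>s<length js. e < gs ! s \<longrightarrow> e < js ! s) \<and>
    (\<forall>k. R k \<le> card {e \<in> E - set gs. k \<le> e})"
  using assms(1,2,4)
proof (induction js arbitrary: E)
  case Nil
  then show ?case by simp
next
  case (Cons b js)
  have H: "card {j \<in> set (b # js). k \<le> j} + R k \<le> card {e \<in> E. k \<le> e}" for k by fact
  have bjs: "\<And>j. j \<in> set js \<Longrightarrow> b < j" using Cons.prems by auto
  have "b \<in> {j \<in> set (b # js). b \<le> j}" by simp
  then have "0 < card {j \<in> set (b # js). b \<le> j}" using card_gt_0_iff by (metis empty_iff finite_Collect_conjI finite_set Collect_mem_eq)
  then have "{e \<in> E. b \<le> e} \<noteq> {}" using H[of b] by (metis add_is_0 card.empty le_zero_eq less_numeral_extra(3))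
  define e where "e = Min {e \<in> E. b \<le> e}"
  have "e \<in> {e \<in> E. b \<le> e}" unfolding e_def using \<open>{e \<in> E. b \<le> e} \<noteq> {}\<close> Cons.prems(1) by (intro Min_in) auto
  then have e: "e \<in> E" "b \<le> e" by auto
  have emin: "e \<le> f" if "f \<in> E" "b \<le> f" for f
    unfolding e_def using that Cons.prems(1) by (intro Min_le) auto
  have H': "card {j \<in> set js. k \<le> j} + R k \<le> card {f \<in> E - {e}. k \<le> f}" for k
  proof -
    have caseb: "card {j \<in> set js. k \<le> j} + R k \<le> card {f \<in> E - {e}. k \<le> f}" if "k \<le> b" for k
    proof -
      have "{j \<in> set (b # js). k \<le> j} = insert b {j \<in> set js. k \<le> j}" using that by auto
      then have "card {j \<in> set (b # js). k \<le> j} = Suc (card {j \<in> set js. k \<le> j})"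
        using bjs by (auto simp: card_insert_if)
      moreover have "{f \<in> E. k \<le> f} = insert e {f \<in> E - {e}. k \<le> f}" using that e by auto
      then have "card {f \<in> E. k \<le> f} = Suc (card {f \<in> E - {e}. k \<le> f})"
        using Cons.prems(1) by (auto simp: card_insert_if)
      ultimately show ?thesis using H[of k] by simp
    qed
    consider "k \<le> b" | "b < k" "k \<le> e" | "e < k" by linarith
    then show ?thesis
    proof cases
      case 1 then show ?thesis by (rule caseb)
    next
      case 2
      have "{f \<in> E - {e}. b \<le> f} = {f \<in> E - {e}. k \<le> f}" using 2 emin by fastforce
      moreover have "card {j \<in> set js. k \<le> j} \<le> card {j \<in> set js. b \<le> j}"
        using 2 by (intro card_mono) auto
      ultimately show ?thesis using caseb[of b] R[of b k] 2 by simp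
    next
      case 3
      have "{f \<in> E - {e}. k \<le> f} = {f \<in> E. k \<le> f}" using 3 by auto
      moreover have "{j \<in> set (b # js). k \<le> j} = {j \<in> set js. k \<le> j}" using 3 e by auto
      ultimately show ?thesis using H[of k] by simp
    qed
  qed
  obtain gs where gs: "length gs = length js" "sorted_wrt (<) gs" "set gs \<subseteq> E - {e}"
    "\<forall>s<length js. js ! s \<le> gs ! s"
    "\<forall>f\<in>E - {e} - set gs. \<forall>s<length js. f < gs ! s \<longrightarrow> f < js ! s"
    "\<forall>k. R k \<le> card {f \<in> E - {e} - set gs. k \<le> f}"
    using Cons.IH[of "E - {e}"] Cons.prems H' by auto
  have egs: "e < g" if g: "g \<in> set gs" for g
  proof -
    obtain s where s: "s < length js" "g = gs ! s" using g gs(1) by (auto simp: in_set_conv_nth)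
    then have "b < g" using gs(4) bjs[of "js ! s"] by force
    then show ?thesis using emin[of g] g gs(3) by force
  qed
  show ?case
  proof (intro exI[of _ "e # gs"] conjI allI ballI impI)
    show "(b # js) ! s \<le> (e # gs) ! s" if "s < length (b # js)" for s
      using that gs(4) e by (cases s) auto
    show "f < (b # js) ! s" if "f \<in> E - set (e # gs)" "s < length (b # js)" "f < (e # gs) ! s" for f s
      using that gs(5) emin[of f] by (cases s) (auto simp: not_less[symmetric])
    have "E - set (e # gs) = E - {e} - set gs" by auto
    then show "R k \<le> card {f \<in> E - set (e # gs). k \<le> f}" for k using gs(6) by simp
  qed (use gs egs e in auto)
qed

lemma degree_lincomb:
  assumes "finite E" "\<And>e. e \<in> E \<Longrightarrow> degree (q e) = e"
  shows "(\<Sum>e\<in>E. smult (a e) (q e)) = (0 :: complex poly) \<or> degree (\<Sum>e\<in>E. smult (a e) (q e)) \<in> E"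
  using assms
proof (induction E)
  case empty
  then show ?case by simp
next
  case (insert e E)
  let ?S = "\<Sum>e\<in>E. smult (a e) (q e)"
  have IH: "?S = 0 \<or> degree ?S \<in> E" using insert by auto
  have eq: "(\<Sum>e\<in>insert e E. smult (a e) (q e)) = smult (a e) (q e) + ?S" using insert by simp
  consider "a e = 0" | "?S = 0" "a e \<noteq> 0" | "?S \<noteq> 0" "a e \<noteq> 0" by blast
  then show ?case
  proof cases
    case 3
    then have "degree ?S \<in> E" "degree (smult (a e) (q e)) = e" using IH insert by auto
    moreover have "degree ?S \<noteq> e" using calculation insert by auto
    ultimately show ?thesis unfolding eq
      using degree_add_eq_left[of ?S "smult (a e) (q e)"] degree_add_eq_right[of "smult (a e) (q e)" ?S]
      by (cases "degree ?S < e") auto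
  qed (use IH insert eq in auto)
qed

lemma dval_eq_0: "degree p < j \<Longrightarrow> dval j x p = 0"
  by (simp add: dval_def higher_pderiv_eq_0)

text \<open>
  Outside finitely many points all leading minors of the Wronskian of the polynomials with
  degrees in \<open>gs\<close> are nonzero. An element of degree \<open>e\<close> outside \<open>gs\<close> can then be
  corrected by matched elements of smaller degree so as to satisfy the conditions whose matched degree lies below
  \<open>e\<close>; the remaining conditions have order above \<open>e\<close> and hold trivially. Conversely, no
  nonzero combination of the matched elements satisfies all conditions.
\<close>

lemma generic_node:
  assumes V: "poly_space.subspace V" and fin: "finite (degs V)"
    and js: "sorted_wrt (<) js" and gs: "length gs = length js" "sorted_wrt (<) gs" "set gs \<subseteq> degs V"
    and le: "\<And>s. s < length js \<Longrightarrow> js ! s \<le> gs ! s"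
    and skip: "\<And>e s. e \<in> degs V - set gs \<Longrightarrow> s < length js \<Longrightarrow> e < gs ! s \<Longrightarrow> e < js ! s"
  shows "finite {x. degs {p \<in> V. \<forall>j\<in>set js. dval j x p = 0} \<noteq> degs V - set gs}"
proof -
  let ?c = "length js"
  have "\<exists>q. e \<in> degs V \<longrightarrow> q \<in> V \<and> degree q = e \<and> lead_coeff q = 1" for e
  proof (cases "e \<in> degs V")
    case True
    then obtain q where q: "q \<in> V" "q \<noteq> 0" "degree q = e" by (rule degsE)
    then show ?thesis using poly_space.subspace_scale[OF V q(1)]
      by (intro exI[of _ "smult (inverse (lead_coeff q)) q"]) auto
  qed simp
  then obtain q where q: "\<And>e. e \<in> degs V \<Longrightarrow> q e \<in> V \<and> degree (q e) = e \<and> lead_coeff (q e) = 1"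
    by metis
  have q0: "q e \<noteq> 0" if "e \<in> degs V" for e using q[OF that] by auto
  have gV: "gs ! s \<in> degs V" if "s < ?c" for s using that gs by auto
  have q': "degree (q (gs ! s)) = gs ! s \<and> lead_coeff (q (gs ! s)) = 1" if "s < ?c" for s
    using q[OF gV[OF that]] by blast
  have gmono: "gs ! a < gs ! b" if "a < b" "b < ?c" for a b
    using that gs by (auto simp: sorted_wrt_iff_nth_less)
  have jmono: "js ! a < js ! b" if "a < b" "b < ?c" for a b
    using that js by (auto simp: sorted_wrt_iff_nth_less)
  define bad where "bad = (\<Union>t\<le>?c. {x. det (mat t t (\<lambda>(r, s). dval (js ! r) x (q (gs ! s)))) = 0})"
  have bad: "finite bad" unfolding bad_def
  proof (intro finite_UN_I)
    fix t assume "t \<in> {..?c}"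
    then show "finite {x. det (mat t t (\<lambda>(r, s). dval (js ! r) x (q (gs ! s)))) = 0}"
    proof (intro finite_singular_jets[of t "(!) gs"])
      fix s assume "s < t"
      then have "s < ?c" using \<open>t \<in> {..?c}\<close> by simp
      then show "degree (q (gs ! s)) = gs ! s \<and> lead_coeff (q (gs ! s)) = 1" by (rule q')
    qed (use gmono jmono le \<open>t \<in> {..?c}\<close> in auto)
  qed simp
  have "degs {p \<in> V. \<forall>j\<in>set js. dval j x p = 0} = degs V - set gs" (is "degs ?V' = _")
    if "x \<notin> bad" for x
  proof -
    have nz: "det (mat t t (\<lambda>(r, s). dval (js ! r) x (q (gs ! s)))) \<noteq> 0" if "t \<le> ?c" for t
      using \<open>x \<notin> bad\<close> that by (auto simp: bad_def)
    have V': "poly_space.subspace ?V'" by (intro subspace_kernel V functional_dval)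
    have ex: "\<exists>r. r \<in> ?V' \<and> r \<noteq> 0 \<and> degree r = e" if e: "e \<in> degs V - set gs" for e
    proof -
      \<comment> \<open>\<open>t\<close> is the number of matched degrees below \<open>e\<close>.\<close>
      define t where "t = (LEAST s. s = ?c \<or> e \<le> gs ! s)"
      have t: "t = ?c \<or> e \<le> gs ! t" unfolding t_def by (rule LeastI[of _ ?c]) simp
      have tc: "t \<le> ?c" unfolding t_def by (rule Least_le) simp
      have below: "gs ! s < e" if "s < t" for s
        using not_less_Least[of s "\<lambda>s. s = ?c \<or> e \<le> gs ! s"] that tc unfolding t_def by auto
      have above: "e < gs ! s" if "t \<le> s" "s < ?c" for s
      proof -
        have "e \<le> gs ! s" using that t gmono[of t s] by (cases "s = t") auto
        moreover have "gs ! s \<in> set gs" using that gs by auto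
        then have "gs ! s \<noteq> e" using e by auto
        ultimately show ?thesis by simp
      qed
      obtain a where a: "\<And>r. r < t \<Longrightarrow>
          (\<Sum>s<t. dval (js ! r) x (q (gs ! s)) * a s) = - dval (js ! r) x (q e)"
        using det_mat_nonzero_solve[OF nz[OF tc], of "\<lambda>r. - dval (js ! r) x (q e)"] by blast
      define u where "u = (\<Sum>s<t. smult (a s) (q (gs ! s)))"
      define r where "r = q e + u"
      have qe: "q e \<in> V" "degree (q e) = e" "coeff (q e) e = 1" using q[of e] e by auto
      have qg: "degree (q (gs ! s)) < e" if "s < t" for s
        using below[OF that] q[OF gV[of s]] that tc by simp
      have "coeff u e = 0" unfolding u_def coeff_sum
        using qg by (intro sum.neutral) (auto simp: coeff_eq_0)
      then have cr: "coeff r e = 1" unfolding r_def using qe by simp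
      have "degree u \<le> e" unfolding u_def
        using qg by (intro degree_sum_le) (auto intro: order_trans[OF degree_smult_le] less_imp_le)
      then have "degree r \<le> e" unfolding r_def using qe by (intro degree_add_le) auto
      moreover have "e \<le> degree r" using cr by (intro le_degree) simp
      ultimately have dr: "degree r = e" by simp
      have "u \<in> V" unfolding u_def
        using q gV tc by (intro poly_space.subspace_sum[OF V] poly_space.subspace_scale[OF V]) auto
      then have "r \<in> V" unfolding r_def using qe V by (intro poly_space.subspace_add) auto
      moreover have "dval (js ! k) x r = 0" if "k < ?c" for k
      proof (cases "k < t")
        case True
        have "dval (js ! k) x r = dval (js ! k) x (q e) + (\<Sum>s<t. a s * dval (js ! k) x (q (gs ! s)))"
          unfolding r_def u_def by (simp add: functionalD[OF functional_dval])
        then show ?thesis using a[OF True] by (simp add: mult.commute)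
      next
        case False
        then have "e < js ! k" using skip[OF e that] above[of k] that by auto
        then show ?thesis using dr by (intro dval_eq_0) simp
      qed
      ultimately have "r \<in> ?V'" by (auto simp: in_set_conv_nth)
      moreover have "r \<noteq> 0" using cr by auto
      ultimately show ?thesis using dr by blast
    qed
    then obtain r where r: "\<And>e. e \<in> degs V - set gs \<Longrightarrow> r e \<in> ?V' \<and> r e \<noteq> 0 \<and> degree (r e) = e"
      using that[of "\<lambda>e. SOME r. r \<in> ?V' \<and> r \<noteq> 0 \<and> degree r = e"] someI_ex[OF ex] by blast
    show ?thesis
    proof
      show "degs V - set gs \<subseteq> degs ?V'"
      proof
        fix e assume "e \<in> degs V - set gs"
        then show "e \<in> degs ?V'" using r[of e] unfolding degs_def[of ?V'] by (intro image_eqI[of _ _ "r e"]) auto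
      qed
      show "degs ?V' \<subseteq> degs V - set gs"
      proof
        fix d assume "d \<in> degs ?V'"
        then obtain p where p: "p \<in> ?V'" "p \<noteq> 0" "degree p = d" by (rule degsE)
        define q' where "q' e = (if e \<in> set gs then q e else r e)" for e
        have "q' e \<in> V \<and> q' e \<noteq> 0 \<and> degree (q' e) = e" if "e \<in> degs V" for e
          using q[OF that] q0[OF that] r[of e] that by (auto simp: q'_def)
        then obtain a where a: "p = (\<Sum>e\<in>degs V. smult (a e) (q' e))"
          using degs_spanning[OF V subset_refl fin, of q' p] p by auto
        define u where "u = (\<Sum>e\<in>degs V - set gs. smult (a e) (r e))"
        define w where "w = (\<Sum>s<?c. smult (a (gs ! s)) (q (gs ! s)))"
        have "bij_betw ((!) gs) {..<?c} (set gs)"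
          using bij_betw_nth[of gs "{..<?c}" "set gs"] gs by (auto simp: strict_sorted_iff)
        then have w: "w = (\<Sum>e\<in>set gs. smult (a e) (q e))"
          unfolding w_def by (rule sum.reindex_bij_betw)
        have "p = u + w"
          unfolding a u_def w by (subst sum.subset_diff[OF gs(3) fin])
             (auto simp: q'_def intro!: arg_cong2[of _ _ _ _ "(+)"] sum.cong)
        have uV: "u \<in> ?V'" unfolding u_def
          using r by (intro poly_space.subspace_sum[OF V'] poly_space.subspace_scale[OF V']) auto
        have "a (gs ! s) = 0" if "s < ?c" for s
        proof (rule ccontr)
          assume "a (gs ! s) \<noteq> 0"
          moreover have "(\<Sum>s<?c. dval (js ! k) x (q (gs ! s)) * a (gs ! s)) = 0" if "k < ?c" for k
          proof -
            have "w = p - u" using \<open>p = u + w\<close> by simp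
            then have "w \<in> ?V'" using poly_space.subspace_diff[OF V' p(1) uV] by simp
            then have "dval (js ! k) x w = 0" using that by auto
            then show ?thesis unfolding w_def by (simp add: functionalD[OF functional_dval] mult.commute)
          qed
          ultimately have "det (mat ?c ?c (\<lambda>(r, s). dval (js ! r) x (q (gs ! s)))) = 0"
            unfolding det_mat_eq_0_iff using \<open>s < ?c\<close> by (intro exI[of _ "\<lambda>s. a (gs ! s)"]) auto
          then show False using nz[of ?c] by simp
        qed
        then have "w = 0" unfolding w_def by simp
        then have "p = u" using \<open>p = u + w\<close> by simp
        then show "d \<in> degs V - set gs"
          using degree_lincomb[of "degs V - set gs" r a] r fin p by (auto simp: u_def)
      qed
    qed
  qed
  then have "{x. degs {p \<in> V. \<forall>j\<in>set js. dval j x p = 0} \<noteq> degs V - set gs} \<subseteq> bad" by blast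
  then show ?thesis using bad by (rule finite_subset)
qed

section \<open>Realising patterns at generic nodes\<close>

definition vanish :: "nat \<Rightarrow> (nat \<Rightarrow> complex) \<Rightarrow> (nat \<times> nat) set \<Rightarrow> complex poly set" where
  "vanish n x A = {p \<in> {p. degree p \<le> n}. \<forall>a\<in>A. dval (snd a) (x (fst a)) p = 0}"

lemma subspace_vanish: "poly_space.subspace (vanish n x A)"
  unfolding vanish_def by (intro subspace_kernel subspace_degree_le functional_dval)

lemma finite_degs_vanish: "finite (degs (vanish n x A))"
  by (rule finite_subset[of _ "{..n}"]) (auto simp: vanish_def degs_def)

lemma vanish_insert: "vanish n x (insert a A) = {p \<in> vanish n x A. dval (snd a) (x (fst a)) p = 0}"
  by (auto simp: vanish_def)

lemma card_degs_vanish: "finite A \<Longrightarrow> n + 1 \<le> card (degs (vanish n x A)) + card A"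
  unfolding vanish_def
  using card_degs_kernel[OF subspace_degree_le[of n], of A "\<lambda>a. dval (snd a) (x (fst a))"]
  by (simp add: degs_degree_le functional_dval)

text \<open>
  The nodes are chosen one after the other. A finite family \<open>F\<close> of condition sets is treated
  simultaneously, since each member excludes only finitely many values of the next node. The invariant is
  the Hall-type condition between the orders still to come and the degrees that are left.
\<close>

lemma generic_nodes:
  assumes F: "finite F"
    and A: "\<And>A. A \<in> F \<Longrightarrow> finite A"
    and polya: "\<And>A k. A \<in> F \<Longrightarrow> card {a \<in> A. k \<le> snd a} \<le> n + 1 - k"
  shows "\<exists>x. inj_on x {..<i} \<and> (\<forall>A\<in>F.
    (\<forall>k. card {a \<in> A. i \<le> fst a \<and> k \<le> snd a} \<le> card {e \<in> degs (vanish n x {a \<in> A. fst a < i}). k \<le> e}) \<and>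
    card (degs (vanish n x {a \<in> A. fst a < i})) + card {a \<in> A. fst a < i} = n + 1)"
proof (induction i)
  case 0
  have "{e. e \<le> n \<and> k \<le> e} = {k..n}" for k by auto
  moreover have "degs (vanish n x {}) = {..n}" for x by (simp add: vanish_def degs_degree_le)
  ultimately show ?case using polya by auto
next
  case (Suc i)
  then obtain x where inj: "inj_on x {..<i}"
    and IH: "\<And>A k. A \<in> F \<Longrightarrow> card {a \<in> A. i \<le> fst a \<and> k \<le> snd a}
        \<le> card {e \<in> degs (vanish n x {a \<in> A. fst a < i}). k \<le> e}"
      "\<And>A. A \<in> F \<Longrightarrow> card (degs (vanish n x {a \<in> A. fst a < i})) + card {a \<in> A. fst a < i} = n + 1"
    by blast
  define V where "V A = vanish n x {a \<in> A. fst a < i}" for A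
  define J where "J A = {j. (i, j) \<in> A}" for A :: "(nat \<times> nat) set"
  have finJ: "finite (J A)" if "A \<in> F" for A
    unfolding J_def using finite_vimageI[OF A[OF that], of "Pair i"] by (simp add: vimage_def inj_def)
  have split: "card {j \<in> J A. k \<le> j} + card {a \<in> A. Suc i \<le> fst a \<and> k \<le> snd a}
      = card {a \<in> A. i \<le> fst a \<and> k \<le> snd a}" if "A \<in> F" for A k
  proof -
    have "{a \<in> A. i \<le> fst a \<and> k \<le> snd a} =
        Pair i ` {j \<in> J A. k \<le> j} \<union> {a \<in> A. Suc i \<le> fst a \<and> k \<le> snd a}"
      by (auto simp: J_def image_iff Suc_le_eq le_less)
    then show ?thesis using A[OF that] finJ[OF that]
      by (simp, subst card_Un_disjoint) (auto simp: card_image inj_on_def)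
  qed
  have "\<exists>G. card G = card (J A) \<and> G \<subseteq> degs (V A) \<and>
      finite {y. degs {p \<in> V A. \<forall>j\<in>J A. dval j y p = 0} \<noteq> degs (V A) - G} \<and>
      (\<forall>k. card {a \<in> A. Suc i \<le> fst a \<and> k \<le> snd a} \<le> card {e \<in> degs (V A) - G. k \<le> e})"
    if AF: "A \<in> F" for A
  proof -
    define js where "js = sorted_list_of_set (J A)"
    have js: "set js = J A" "sorted_wrt (<) js" "length js = card (J A)"
      unfolding js_def using finJ[OF AF] by auto
    have mono: "card {a \<in> A. Suc i \<le> fst a \<and> l \<le> snd a} \<le> card {a \<in> A. Suc i \<le> fst a \<and> k \<le> snd a}"
      if "k \<le> l" for k l using that A[OF AF] by (intro card_mono) auto
    have polya_js: "card {j \<in> set js. k \<le> j} + card {a \<in> A. Suc i \<le> fst a \<and> k \<le> snd a}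
        \<le> card {e \<in> degs (V A). k \<le> e}" for k
      using IH(1)[OF AF] split[OF AF] js by (simp add: V_def)
    obtain gs where gs: "length gs = length js" "sorted_wrt (<) gs" "set gs \<subseteq> degs (V A)"
      "\<forall>s<length js. js ! s \<le> gs ! s"
      "\<forall>e\<in>degs (V A) - set gs. \<forall>s<length js. e < gs ! s \<longrightarrow> e < js ! s"
      "\<forall>k. card {a \<in> A. Suc i \<le> fst a \<and> k \<le> snd a} \<le> card {e \<in> degs (V A) - set gs. k \<le> e}"
      using greedy_transversal[of "degs (V A)" js "\<lambda>k. card {a \<in> A. Suc i \<le> fst a \<and> k \<le> snd a}",
        OF finite_degs_vanish[of n x "{a \<in> A. fst a < i}", folded V_def] js(2) mono polya_js]
      by blast
    show ?thesis
    proof (intro exI[of _ "set gs"] conjI)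
      show "card (set gs) = card (J A)"
        using gs(1,2) js by (auto simp: strict_sorted_iff distinct_card)
      have "finite {y. degs {p \<in> V A. \<forall>j\<in>set js. dval j y p = 0} \<noteq> degs (V A) - set gs}"
        by (rule generic_node) (use gs js in \<open>auto simp: V_def subspace_vanish finite_degs_vanish\<close>)
      then show "finite {y. degs {p \<in> V A. \<forall>j\<in>J A. dval j y p = 0} \<noteq> degs (V A) - set gs}"
        using js by simp
    qed (use gs in auto)
  qed
  then have "\<exists>G. \<forall>A\<in>F. card (G A) = card (J A) \<and> G A \<subseteq> degs (V A) \<and>
      finite {y. degs {p \<in> V A. \<forall>j\<in>J A. dval j y p = 0} \<noteq> degs (V A) - G A} \<and>
      (\<forall>k. card {a \<in> A. Suc i \<le> fst a \<and> k \<le> snd a} \<le> card {e \<in> degs (V A) - G A. k \<le> e})"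
    by (intro bchoice ballI)
  then obtain G where G: "\<And>A. A \<in> F \<Longrightarrow> card (G A) = card (J A) \<and> G A \<subseteq> degs (V A) \<and>
      finite {y. degs {p \<in> V A. \<forall>j\<in>J A. dval j y p = 0} \<noteq> degs (V A) - G A} \<and>
      (\<forall>k. card {a \<in> A. Suc i \<le> fst a \<and> k \<le> snd a} \<le> card {e \<in> degs (V A) - G A. k \<le> e})"
    by blast
  define bad where "bad = (\<Union>A\<in>F. {y. degs {p \<in> V A. \<forall>j\<in>J A. dval j y p = 0} \<noteq> degs (V A) - G A}) \<union> x ` {..<i}"
  have "finite bad" unfolding bad_def using F G by auto
  then obtain y where y: "y \<notin> bad" using ex_new_if_finite[OF infinite_UNIV_char_0] by blast
  define x' where "x' = x(i := y)"
  have V': "degs (vanish n x' {a \<in> A. fst a < Suc i}) = degs (V A) - G A" if "A \<in> F" for A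
  proof -
    have "vanish n x' {a \<in> A. fst a < Suc i} = {p \<in> V A. \<forall>j\<in>J A. dval j y p = 0}"
      unfolding V_def vanish_def J_def x'_def by (auto simp: less_Suc_eq) 
    then show ?thesis using y that by (auto simp: bad_def)
  qed
  show ?case
  proof (intro exI[of _ x'] conjI ballI allI)
    show "inj_on x' {..<Suc i}"
      using inj y by (auto simp: x'_def bad_def inj_on_def less_Suc_eq)
    fix A assume AF: "A \<in> F"
    show "card {a \<in> A. Suc i \<le> fst a \<and> k \<le> snd a}
        \<le> card {e \<in> degs (vanish n x' {a \<in> A. fst a < Suc i}). k \<le> e}" for k
      using G[OF AF] unfolding V'[OF AF] by blast
    have "card {a \<in> A. fst a < Suc i} = card {a \<in> A. fst a < i} + card (J A)"
    proof -
      have "{a \<in> A. fst a < Suc i} = {a \<in> A. fst a < i} \<union> Pair i ` J A"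
        by (auto simp: J_def image_iff less_Suc_eq)
      then show ?thesis using A[OF AF] finJ[OF AF]
        by (simp, subst card_Un_disjoint) (auto simp: card_image inj_on_def)
    qed
    moreover have "card (degs (V A) - G A) + card (G A) = card (degs (V A))"
    proof -
      have fin: "finite (degs (V A))" by (simp add: V_def finite_degs_vanish)
      have sub: "G A \<subseteq> degs (V A)" using G[OF AF] by blast
      show ?thesis
        using card_Diff_subset[OF finite_subset[OF sub fin] sub] card_mono[OF fin sub] by simp
    qed
    ultimately show "card (degs (vanish n x' {a \<in> A. fst a < Suc i})) + card {a \<in> A. fst a < Suc i} = n + 1"
      using IH(2)[OF AF] G[OF AF] unfolding V'[OF AF] by (simp add: V_def)
  qed
qed

text \<open>
  For every pair \<open>f\<close> outside \<open>B\<close> the conditions \<open>insert f B\<close> force the zero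
  polynomial at generic nodes, so a nonzero \<open>P\<close> satisfying \<open>B\<close> violates \<open>f\<close>. The choice
  \<open>f = (0, n)\<close> shows that \<open>P\<close> has degree \<open>n\<close>.
\<close>

lemma exists_pattern:
  fixes m n :: nat
  assumes m: "0 < m" and B: "B \<subseteq> {..<m} \<times> {..<n}" and card: "card B = n"
    and polya: "\<And>k. k \<le> n \<Longrightarrow> card {b \<in> B. k \<le> snd b} \<le> n - k"
  shows "\<exists>x P. inj_on x {..<m} \<and> P \<noteq> 0 \<and> degree P = n \<and>
    (\<forall>i<m. \<forall>j\<le>n. dval j (x i) P = 0 \<longleftrightarrow> (i, j) \<in> B)"
proof -
  have finB: "finite B" using B by (rule finite_subset) auto
  \<comment> \<open>One condition set for each pair whose condition has to fail.\<close>
  define F where "F = (\<lambda>f. insert f B) ` ({..<m} \<times> {..n} - B)"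
  have "\<exists>x. inj_on x {..<m} \<and> (\<forall>A\<in>F.
    (\<forall>k. card {a \<in> A. m \<le> fst a \<and> k \<le> snd a} \<le> card {e \<in> degs (vanish n x {a \<in> A. fst a < m}). k \<le> e}) \<and>
    card (degs (vanish n x {a \<in> A. fst a < m})) + card {a \<in> A. fst a < m} = n + 1)"
  proof (rule generic_nodes)
    fix A k assume "A \<in> F"
    then obtain f where f: "f \<in> {..<m} \<times> {..n}" "A = insert f B" by (auto simp: F_def)
    show "card {a \<in> A. k \<le> snd a} \<le> n + 1 - k"
    proof (cases "k \<le> n")
      case True
      have "{a \<in> A. k \<le> snd a} \<subseteq> insert f {b \<in> B. k \<le> snd b}" using f by auto
      then have "card {a \<in> A. k \<le> snd a} \<le> card (insert f {b \<in> B. k \<le> snd b})"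
        using finB by (intro card_mono) auto
      also have "\<dots> \<le> Suc (card {b \<in> B. k \<le> snd b})" using finB by (simp add: card_insert_if)
      also have "\<dots> \<le> n + 1 - k" using polya[OF True] True by simp
      finally show ?thesis .
    next
      case False
      then have "{a \<in> A. k \<le> snd a} = {}" using f B by auto
      then show ?thesis by (simp only: card.empty le0)
    qed
  qed (use finB in \<open>auto simp: F_def\<close>)
  then obtain x where inj: "inj_on x {..<m}"
    and x: "\<And>A. A \<in> F \<Longrightarrow> card (degs (vanish n x {a \<in> A. fst a < m})) + card {a \<in> A. fst a < m} = n + 1"
    by blast
  have zero: "vanish n x (insert f B) = {0}" if f: "f \<in> {..<m} \<times> {..n} - B" for f
  proof -
    have "{a \<in> insert f B. fst a < m} = insert f B" using f B by auto
    then have "card (degs (vanish n x (insert f B))) + card (insert f B) = n + 1"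
      using x[of "insert f B"] f by (simp add: F_def)
    moreover have "card (insert f B) = n + 1" using f finB card by simp
    ultimately have "degs (vanish n x (insert f B)) = {}"
      using finite_degs_vanish[of n x "insert f B"] by simp
    then show ?thesis using degs_empty_iff[OF subspace_vanish] by blast
  qed
  have "1 \<le> card (degs (vanish n x B))" using card_degs_vanish[OF finB, of n x] card by simp
  then obtain d where "d \<in> degs (vanish n x B)" by fastforce
  then obtain P where P: "P \<in> vanish n x B" "P \<noteq> 0" by (rule degsE)
  have pat: "dval j (x i) P = 0 \<longleftrightarrow> (i, j) \<in> B" if "i < m" "j \<le> n" for i j
  proof
    assume d: "dval j (x i) P = 0"
    show "(i, j) \<in> B"
    proof (rule ccontr)
      assume "(i, j) \<notin> B"
      then have "vanish n x (insert (i, j) B) = {0}" using that by (intro zero) auto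
      moreover have "P \<in> vanish n x (insert (i, j) B)" using P d by (auto simp: vanish_insert)
      ultimately show False using P by auto
    qed
  qed (use P in \<open>force simp: vanish_def\<close>)
  have "(0, n) \<notin> B" using B by auto
  then have "dval n (x 0) P \<noteq> 0" using pat[of 0 n] m by simp
  then have "n \<le> degree P" using dval_eq_0[of P n "x 0"] by (meson not_less)
  then have "degree P = n" using P by (auto simp: vanish_def)
  then show ?thesis using inj P pat by blast
qed

section \<open>Rotation and the lower bound\<close>

text \<open>
  Patterns carry the same information as dope matrices. Nodes are given by a function rather than a
  list so that a single node can be changed by function update.
\<close>

definition patterns :: "nat \<Rightarrow> nat \<Rightarrow> (nat \<times> nat) set set" where
  "patterns m n = {{(i, j). i < m \<and> j \<le> n \<and> dval j (x i) P = 0} | x P.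
     inj_on x {..<m} \<and> P \<noteq> 0 \<and> degree P = n}"

lemma patterns_subset: "patterns m n \<subseteq> Pow ({..<m} \<times> {..n})"
  by (auto simp: patterns_def)

lemma finite_patterns: "finite (patterns m n)"
  by (rule finite_subset[OF patterns_subset]) simp

lemma card_dope_matrices: "card (dope_matrices m n) = card (patterns m n)"
proof -
  define f where "f Z = mat m (n + 1) (\<lambda>b. if b \<in> Z then 1 else 0 :: nat)" for Z :: "(nat \<times> nat) set"
  have f: "f {(i, j). i < m \<and> j \<le> n \<and> dval j (x i) P = 0}
      = mat m (n + 1) (\<lambda>(i, j). if poly ((pderiv ^^ j) P) (x i) = 0 then 1 else 0)" for x P
    by (rule eq_matI) (auto simp: f_def dval_def)
  have "f ` patterns m n = dope_matrices m n"
  proof (intro equalityI subsetI)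
    fix D assume "D \<in> f ` patterns m n"
    then obtain x P where xP: "inj_on x {..<m}" "P \<noteq> 0" "degree P = n"
      and D: "D = f {(i, j). i < m \<and> j \<le> n \<and> dval j (x i) P = 0}"
      unfolding patterns_def by blast
    have "D = dope_matrix P (map x [0..<m])"
      unfolding D f dope_matrix_def using xP by (intro eq_matI) auto
    moreover have "distinct (map x [0..<m])" using xP by (simp add: distinct_map atLeast0LessThan)
    ultimately show "D \<in> dope_matrices m n"
      unfolding dope_matrices_def using xP by (auto intro!: exI[of _ P] exI[of _ "map x [0..<m]"])
  next
    fix D assume "D \<in> dope_matrices m n"
    then obtain P \<Lambda> where P: "D = dope_matrix P \<Lambda>" "P \<noteq> 0" "degree P = n" "length \<Lambda> = m" "distinct \<Lambda>"
      unfolding dope_matrices_def by blast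
    have "inj_on ((!) \<Lambda>) {..<m}" using P by (simp add: inj_on_nth)
    then have "{(i, j). i < m \<and> j \<le> n \<and> dval j (\<Lambda> ! i) P = 0} \<in> patterns m n"
      unfolding patterns_def using P by blast
    moreover have "D = f {(i, j). i < m \<and> j \<le> n \<and> dval j (\<Lambda> ! i) P = 0}"
      unfolding f P(1) dope_matrix_def using P by simp
    ultimately show "D \<in> f ` patterns m n" by blast
  qed
  moreover have "inj_on f (patterns m n)"
  proof (rule inj_onI)
    fix Z Z' assume Z: "Z \<in> patterns m n" "Z' \<in> patterns m n" and eq: "f Z = f Z'"
    have "b \<in> Z \<longleftrightarrow> b \<in> Z'" if "b \<in> {..<m} \<times> {..n}" for b
    proof -
      have "f Z $$ b = f Z' $$ b" using eq by simp
      then show ?thesis using that by (cases b) (auto simp: f_def split: if_splits)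
    qed
    then show "Z = Z'" using Z patterns_subset[of m n] by blast
  qed
  ultimately show ?thesis using card_image[of f "patterns m n"] by simp
qed

definition balanced :: "nat \<Rightarrow> nat \<Rightarrow> (nat \<times> nat) set set" where
  "balanced m n = {B. B \<subseteq> {..<m} \<times> {..<n} \<and> card B = n \<and> (\<forall>k\<le>n. card {b \<in> B. k \<le> snd b} \<le> n - k)}"

lemma balanced_subset_patterns: "0 < m \<Longrightarrow> balanced m n \<subseteq> patterns m n"
proof
  fix B assume m: "0 < m" and "B \<in> balanced m n"
  then have B: "B \<subseteq> {..<m} \<times> {..<n}" "card B = n" "\<And>k. k \<le> n \<Longrightarrow> card {b \<in> B. k \<le> snd b} \<le> n - k"
    by (auto simp: balanced_def)
  obtain x P where xP: "inj_on x {..<m}" "P \<noteq> 0" "degree P = n"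
    "\<forall>i<m. \<forall>j\<le>n. dval j (x i) P = 0 \<longleftrightarrow> (i, j) \<in> B"
    using exists_pattern[OF m B] by blast
  have "B = {(i, j). i < m \<and> j \<le> n \<and> dval j (x i) P = 0}"
    using B(1) xP(4) by auto
  then show "B \<in> patterns m n" unfolding patterns_def using xP by blast
qed

lemma card_columns:
  fixes B :: "('a \<times> nat) set"
  assumes "finite B"
  shows "card {b \<in> B. snd b < k} = (\<Sum>j<k. card {i. (i, j) \<in> B})"
proof -
  have fin: "finite {i. (i, j) \<in> B}" for j
    using finite_subset[of "{i. (i, j) \<in> B}" "fst ` B"] assms by (force simp: image_iff)
  have "{b \<in> B. snd b < k} = (\<Union>j<k. (\<lambda>i. (i, j)) ` {i. (i, j) \<in> B})" by auto
  also have "card \<dots> = (\<Sum>j<k. card ((\<lambda>i. (i, j)) ` {i. (i, j) \<in> B}))"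
    using fin by (intro card_UN_disjoint) auto
  also have "\<dots> = (\<Sum>j<k. card {i. (i, j) \<in> B})"
    by (intro sum.cong card_image) (auto simp: inj_on_def)
  finally show ?thesis .
qed

text \<open>
  The cycle lemma: the walk with steps \<open>c j - 1\<close> returns to its starting level after a full
  period, so started at its minimum it never goes below its starting level.
\<close>

lemma cyclic_start:
  fixes c :: "nat \<Rightarrow> nat"
  assumes n: "0 < n" and sum: "(\<Sum>j<n. c j) = n"
  shows "\<exists>s<n. \<forall>k\<le>n. k \<le> (\<Sum>j<k. c ((j + s) mod n))"
proof -
  \<comment> \<open>The cyclic walk, unrolled to all of \<open>nat\<close>.\<close>
  define S where "S k = (\<Sum>j<k. int (c (j mod n)) - 1)" for k
  have Sadd: "S (s + k) = S s + (\<Sum>j<k. int (c ((j + s) mod n)) - 1)" for s k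
    by (induction k) (auto simp: S_def ac_simps)
  have Sn: "S n = 0"
  proof -
    have "S n = (\<Sum>j<n. int (c j) - 1)" unfolding S_def by (rule sum.cong) auto
    also have "\<dots> = int (\<Sum>j<n. c j) - int n" by (simp add: sum_subtractf)
    finally show ?thesis using sum by simp
  qed
  have Sper: "S (n + k) = S k" for k
    using Sadd[of n k] Sn by (simp add: S_def)
  define s where "s = arg_min_on S {..<n}"
  have ne: "{..<n} \<noteq> {}" using n by auto
  have s: "s < n" using arg_min_if_finite(1)[OF finite_lessThan ne, of S] by (simp add: s_def)
  have smin: "S s \<le> S k" if "k < n" for k
    using arg_min_if_finite(2)[OF finite_lessThan ne, of S] that by (force simp: s_def not_less[symmetric])
  have "k \<le> (\<Sum>j<k. c ((j + s) mod n))" if k: "k \<le> n" for k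
  proof -
    have "S s \<le> S (s + k)"
    proof (cases "s + k < n")
      case False
      then have "S (s + k) = S (s + k - n)" using Sper[of "s + k - n"] by simp
      then show ?thesis using smin[of "s + k - n"] s k False by simp
    qed (rule smin)
    then have "0 \<le> (\<Sum>j<k. int (c ((j + s) mod n)) - 1)" using Sadd[of s k] by simp
    also have "\<dots> = int (\<Sum>j<k. c ((j + s) mod n)) - int k" by (simp add: sum_subtractf)
    finally show ?thesis by (simp only: of_nat_le_iff diff_ge_0_iff_ge)
  qed
  then show ?thesis using s by blast
qed

text \<open>
  Every \<open>n\<close>-subset of the grid is one of the \<open>n\<close> column rotations of a balanced set.
\<close>

lemma binomial_le_card_balanced:
  assumes n: "0 < n"
  shows "(m * n choose n) \<le> n * card (balanced m n)"
proof -
  define grid where "grid = {..<m} \<times> {..<n}"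
  define rot where "rot s b = (fst b, (snd b + s) mod n)" for s and b :: "nat \<times> nat"
  have rot_in: "rot s b \<in> grid" if "b \<in> grid" for s b using that n by (auto simp: grid_def rot_def)
  have rot_inj: "inj_on (rot s) grid" for s
  proof (rule inj_onI)
    fix b b' assume b: "b \<in> grid" "b' \<in> grid" and eq: "rot s b = rot s b'"
    have "(snd b + s) mod n = (snd b' + s) mod n" using eq by (simp add: rot_def)
    then obtain q q' where "snd b + s + n * q = snd b' + s + n * q'" by (auto simp: nat_mod_eq_iff)
    then have "(snd b + n * q) mod n = (snd b' + n * q') mod n" by simp
    then have "snd b = snd b'" using b by (auto simp: grid_def)
    then show "b = b'" using eq by (auto simp: rot_def prod_eq_iff)
  qed
  have fing: "finite grid" by (simp add: grid_def)
  have rot_surj: "rot s ` grid = grid" for s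
    using rot_in rot_inj by (intro endo_inj_surj[OF fing]) auto
  have "{B. B \<subseteq> grid \<and> card B = n} \<subseteq> (\<lambda>(s, B). rot s ` B) ` ({..<n} \<times> balanced m n)"
  proof
    fix B assume "B \<in> {B. B \<subseteq> grid \<and> card B = n}"
    then have B: "B \<subseteq> grid" "card B = n" by auto
    have finB: "finite B" using B fing finite_subset by blast
    have Bn: "{b \<in> B. snd b < n} = B" using B by (auto simp: grid_def)
    have "(\<Sum>j<n. card {i. (i, j) \<in> B}) = n"
      using card_columns[OF finB, of n] B Bn by simp
    then obtain s where s: "s < n" "\<And>k. k \<le> n \<Longrightarrow> k \<le> (\<Sum>j<k. card {i. (i, (j + s) mod n) \<in> B})"
      using cyclic_start[OF n, of "\<lambda>j. card {i. (i, j) \<in> B}"] by auto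
    define B' where "B' = {b \<in> grid. rot s b \<in> B}"
    have finB': "finite B'" using fing by (simp add: B'_def)
    have img: "rot s ` B' = B"
    proof
      show "B \<subseteq> rot s ` B'"
      proof
        fix b assume "b \<in> B"
        then have "b \<in> rot s ` grid" using B rot_surj[of s] by auto
        then obtain a where "b = rot s a" "a \<in> grid" by (rule imageE)
        then show "b \<in> rot s ` B'" using \<open>b \<in> B\<close> by (auto simp: B'_def)
      qed
    qed (auto simp: B'_def)
    have "card B' = n" using card_image[OF inj_on_subset[OF rot_inj[of s]], of B'] img B by (auto simp: B'_def)
    moreover have "card {b \<in> B'. k \<le> snd b} \<le> n - k" if k: "k \<le> n" for k
    proof -
      have "(\<Sum>j<k. card {i. (i, (j + s) mod n) \<in> B}) = (\<Sum>j<k. card {i. (i, j) \<in> B'})"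
      proof (intro sum.cong arg_cong[of _ _ card])
        fix j assume "j \<in> {..<k}"
        then show "{i. (i, (j + s) mod n) \<in> B} = {i. (i, j) \<in> B'}"
          using k B by (auto simp: B'_def rot_def grid_def)
      qed simp
      then have "k \<le> card {b \<in> B'. snd b < k}"
        using s(2)[OF k] card_columns[OF finB', of k] by simp
      moreover have "card {b \<in> B'. snd b < k} + card {b \<in> B'. k \<le> snd b} = card B'"
      proof -
        have "B' = {b \<in> B'. snd b < k} \<union> {b \<in> B'. k \<le> snd b}" by auto
        moreover have "{b \<in> B'. snd b < k} \<inter> {b \<in> B'. k \<le> snd b} = {}" by auto
        ultimately show ?thesis
          using finB' card_Un_disjoint[of "{b \<in> B'. snd b < k}" "{b \<in> B'. k \<le> snd b}"] by simp
      qed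
      ultimately show ?thesis using \<open>card B' = n\<close> by simp
    qed
    ultimately have "B' \<in> balanced m n" by (auto simp: balanced_def B'_def grid_def)
    then show "B \<in> (\<lambda>(s, B). rot s ` B) ` ({..<n} \<times> balanced m n)"
      using img s by (intro image_eqI[of _ _ "(s, B')"]) auto
  qed
  moreover have finbal: "finite (balanced m n)"
    by (rule finite_subset[of _ "Pow grid"]) (auto simp: balanced_def grid_def)
  ultimately have "card {B. B \<subseteq> grid \<and> card B = n} \<le> card ({..<n} \<times> balanced m n)"
    by (intro surj_card_le) auto
  then show ?thesis using n_subsets[OF fing, of n] by (simp add: grid_def card_cartesian_product)
qed

lemma card_patterns_lower:
  assumes "0 < m" "0 < n"
  shows "(m * n choose n) \<le> n * card (patterns m n)"
  using order_trans[OF binomial_le_card_balanced[OF assms(2), of m]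
    mult_le_mono2[OF card_mono[OF finite_patterns balanced_subset_patterns[OF assms(1)]]]] .

section \<open>Zero patterns of polynomial functions\<close>

interpretation fun_space: vector_space "\<lambda>(c::complex) (f::'x \<Rightarrow> complex) x. c * f x"
  by unfold_locales (auto simp: fun_eq_iff algebra_simps)

lemma sum_fun_apply: "(\<Sum>i\<in>I. f i) x = (\<Sum>i\<in>I. f i x)"
  by (induction I rule: infinite_finite_induct) auto

text \<open>
  The product of the functions that do not vanish at \<open>w Z\<close> vanishes at \<open>w Y\<close> unless
  \<open>Y \<subseteq> Z\<close>. The matrix of these products at the witnesses is therefore triangular with respect to
  inclusion, which makes the products linearly independent.
\<close>

lemma card_zero_patterns_le:
  fixes \<phi> :: "'b \<Rightarrow> 'x \<Rightarrow> complex" and w :: "'b set \<Rightarrow> 'x"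
  assumes fin: "finite \<Z>" "finite F" and sub: "\<And>Z. Z \<in> \<Z> \<Longrightarrow> Z \<subseteq> F"
    and w: "\<And>Z f. Z \<in> \<Z> \<Longrightarrow> f \<in> F \<Longrightarrow> \<phi> f (w Z) = 0 \<longleftrightarrow> f \<in> Z"
    and T: "finite T" "\<And>Z. Z \<in> \<Z> \<Longrightarrow> (\<lambda>x. \<Prod>f\<in>F - Z. \<phi> f x) \<in> fun_space.span T"
  shows "card \<Z> \<le> card T"
proof -
  define g where "g Z x = (\<Prod>f\<in>F - Z. \<phi> f x)" for Z x
  have g: "g Z (w Y) = 0 \<longleftrightarrow> \<not> Y \<subseteq> Z" if "Z \<in> \<Z>" "Y \<in> \<Z>" for Z Y
    using w[OF that(2)] sub[OF that(2)] fin by (auto simp: g_def)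
  have inj: "inj_on g \<Z>"
  proof (rule inj_onI)
    fix Z Y assume ZY: "Z \<in> \<Z>" "Y \<in> \<Z>" "g Z = g Y"
    have "Y \<subseteq> Z" using g[OF ZY(2,2)] g[OF ZY(1,2)] ZY(3) by simp
    moreover have "Z \<subseteq> Y" using g[OF ZY(1,1)] g[OF ZY(2,1)] ZY(3) by simp
    ultimately show "Z = Y" by simp
  qed
  have "fun_space.independent (g ` \<Z>)"
  proof (rule fun_space.independent_if_scalars_zero)
    fix u h assume sum0: "(\<Sum>h\<in>g ` \<Z>. (\<lambda>x. u h * h x)) = 0" and h: "h \<in> g ` \<Z>"
    show "u h = 0"
    proof (rule ccontr)
      assume "u h \<noteq> 0"
      \<comment> \<open>Evaluate at the witness of a largest set that occurs with nonzero coefficient.\<close>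
      define \<Y> where "\<Y> = {Z \<in> \<Z>. u (g Z) \<noteq> 0}"
      have finY: "finite \<Y>" "\<Y> \<noteq> {}" using fin h \<open>u h \<noteq> 0\<close> by (auto simp: \<Y>_def)
      have "Max (card ` \<Y>) \<in> card ` \<Y>" using finY by (intro Max_in) auto
      then obtain Y where Y: "Y \<in> \<Y>" "card Y = Max (card ` \<Y>)" by auto
      have YZ: "Y \<in> \<Z>" using Y by (simp add: \<Y>_def)
      have "(\<Sum>h\<in>g ` \<Z>. (\<lambda>x. u h * h x)) (w Y) = (\<Sum>h\<in>g ` \<Z>. u h * h (w Y))"
        by (rule sum_fun_apply)
      also have "\<dots> = (\<Sum>Z\<in>\<Z>. u (g Z) * g Z (w Y))" by (simp add: sum.reindex[OF inj])
      also have "\<dots> = (\<Sum>Z\<in>{Y}. u (g Z) * g Z (w Y))"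
      proof (rule sum.mono_neutral_right)
        show "\<forall>Z\<in>\<Z> - {Y}. u (g Z) * g Z (w Y) = 0"
        proof (intro ballI, rule ccontr)
          fix Z assume Z: "Z \<in> \<Z> - {Y}" and "u (g Z) * g Z (w Y) \<noteq> 0"
          then have "u (g Z) \<noteq> 0" "Y \<subseteq> Z" using g[of Z Y] YZ by auto
          then have "card Z \<le> card Y" unfolding Y(2) using Z finY by (intro Max_ge) (auto simp: \<Y>_def)
          moreover have "finite Z" using sub[of Z] Z fin finite_subset by blast
          ultimately have "Y = Z" using \<open>Y \<subseteq> Z\<close> card_subset_eq card_mono by (metis le_antisym)
          then show False using Z by simp
        qed
      qed (use fin YZ in auto)
      also have "\<dots> \<noteq> 0" using Y g[OF YZ YZ] by (simp add: \<Y>_def)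
      finally show False unfolding sum0 by simp
    qed
  qed (use fin in simp)
  moreover have "g ` \<Z> \<subseteq> fun_space.span T" using T(2) by (auto simp: g_def[abs_def])
  ultimately have "card (g ` \<Z>) \<le> card T" using fun_space.independent_span_bound[OF T(1)] by blast
  then show ?thesis using card_image[OF inj] by simp
qed

text \<open>
  Polynomials in \<open>m\<close> variables are represented as functions of the nodes, with the degree bounded
  in each variable separately.
\<close>

definition monomials :: "nat \<Rightarrow> nat \<Rightarrow> ((nat \<Rightarrow> complex) \<Rightarrow> complex) set" where
  "monomials m d = (\<lambda>a x. \<Prod>i<m. x i ^ a i) ` (PiE {..<m} (\<lambda>_. {..d}))"

abbreviation polyfun :: "nat \<Rightarrow> nat \<Rightarrow> ((nat \<Rightarrow> complex) \<Rightarrow> complex) set" where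
  "polyfun m d \<equiv> fun_space.span (monomials m d)"

lemma finite_monomials: "finite (monomials m d)"
  unfolding monomials_def by (intro finite_imageI finite_PiE) auto

lemma card_monomials: "card (monomials m d) \<le> (d + 1) ^ m"
proof -
  have "card (monomials m d) \<le> card (PiE {..<m} (\<lambda>_. {..d}))"
    unfolding monomials_def by (intro card_image_le finite_PiE) auto
  then show ?thesis by (simp add: card_PiE)
qed

lemma monomialsI:
  assumes "\<And>i. i < m \<Longrightarrow> a i \<le> d"
  shows "(\<lambda>x. \<Prod>i<m. x i ^ a i) \<in> monomials m d"
  unfolding monomials_def using assms
  by (intro image_eqI[of _ _ "restrict a {..<m}"]) auto

lemma polyfun_mono: "d \<le> e \<Longrightarrow> polyfun m d \<subseteq> polyfun m e"
  unfolding monomials_def by (intro fun_space.span_mono image_mono PiE_mono) auto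

lemma polyfun_0: "(\<lambda>x. 0) \<in> polyfun m d"
  using fun_space.span_zero[of "monomials m d"] by (simp add: zero_fun_def)

lemma polyfun_add: "f \<in> polyfun m d \<Longrightarrow> g \<in> polyfun m d \<Longrightarrow> (\<lambda>x. f x + g x) \<in> polyfun m d"
  using fun_space.span_add[of f "monomials m d" g] by (simp add: plus_fun_def)

lemma polyfun_scale: "f \<in> polyfun m d \<Longrightarrow> (\<lambda>x. c * f x) \<in> polyfun m d"
  by (rule fun_space.span_scale)

lemma polyfun_power:
  assumes "i < m" "k \<le> d"
  shows "(\<lambda>x. c * x i ^ k) \<in> polyfun m d"
proof -
  have "(\<lambda>x. \<Prod>j<m. x j ^ (if j = i then k else 0)) \<in> monomials m d"
    using assms by (intro monomialsI) auto
  moreover have "(\<Prod>j<m. x j ^ (if j = i then k else 0)) = x i ^ k" for x :: "nat \<Rightarrow> complex"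
    using assms by (subst prod.remove[of _ i]) (auto intro!: prod.neutral)
  ultimately show ?thesis by (intro polyfun_scale fun_space.span_base) simp
qed

lemma polyfun_const: "(\<lambda>x. c) \<in> polyfun m d"
proof -
  have "(\<lambda>x. \<Prod>j<m. x j ^ 0) \<in> monomials m d" by (intro monomialsI) auto
  then have "(\<lambda>x. c * (\<Prod>j<m. x j ^ 0)) \<in> polyfun m d" by (intro polyfun_scale fun_space.span_base)
  then show ?thesis by simp
qed

lemma polyfun_mult:
  assumes f: "f \<in> polyfun m d" and g: "g \<in> polyfun m e"
  shows "(\<lambda>x. f x * g x) \<in> polyfun m (d + e)"
proof -
  have base: "(\<lambda>x. f x * g x) \<in> polyfun m (d + e)" if fg: "f \<in> monomials m d" "g \<in> monomials m e" for f g
  proof -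
    obtain a b where ab: "a \<in> PiE {..<m} (\<lambda>_. {..d})" "b \<in> PiE {..<m} (\<lambda>_. {..e})"
      "f = (\<lambda>x. \<Prod>i<m. x i ^ a i)" "g = (\<lambda>x. \<Prod>i<m. x i ^ b i)"
      using fg by (auto simp: monomials_def)
    have "a i + b i \<le> d + e" if "i < m" for i
      using ab(1,2) that by (intro add_mono) (auto simp: PiE_iff)
    then have "(\<lambda>x. \<Prod>i<m. x i ^ (a i + b i)) \<in> monomials m (d + e)" by (rule monomialsI)
    then show ?thesis unfolding ab
      by (intro fun_space.span_base) (simp add: power_add prod.distrib)
  qed
  have right: "(\<lambda>x. f x * g x) \<in> polyfun m (d + e)" if "f \<in> monomials m d" for f
    using g
  proof (induction rule: fun_space.span_induct_alt)
    case base
    then show ?case by (simp add: polyfun_0)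
  next
    case (step c h k)
    have "(\<lambda>x. c * (f x * h x) + f x * k x) \<in> polyfun m (d + e)"
      using base[OF that step(1)] step(2) by (intro polyfun_add polyfun_scale)
    then show ?case by (simp add: algebra_simps)
  qed
  show ?thesis
    using f
  proof (induction rule: fun_space.span_induct_alt)
    case base
    then show ?case by (simp add: polyfun_0)
  next
    case (step c h k)
    have "(\<lambda>x. c * (h x * g x) + k x * g x) \<in> polyfun m (d + e)"
      using right[OF step(1)] step(2) by (intro polyfun_add polyfun_scale)
    then show ?case by (simp add: algebra_simps)
  qed
qed

lemma polyfun_sum:
  assumes "\<And>i. i \<in> I \<Longrightarrow> f i \<in> polyfun m d"
  shows "(\<lambda>x. \<Sum>i\<in>I. f i x) \<in> polyfun m d"
  using assms by (induction I rule: infinite_finite_induct) (auto intro: polyfun_0 polyfun_add)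

lemma polyfun_prod:
  assumes "\<And>i. i \<in> I \<Longrightarrow> f i \<in> polyfun m d"
  shows "(\<lambda>x. \<Prod>i\<in>I. f i x) \<in> polyfun m (card I * d)"
  using assms
proof (induction I rule: infinite_finite_induct)
  case (insert i I)
  then have "(\<lambda>x. f i x * (\<Prod>i\<in>I. f i x)) \<in> polyfun m (d + card I * d)" by (intro polyfun_mult) auto
  then show ?case using insert by simp
qed (auto intro: polyfun_const)

lemma polyfun_det:
  assumes "\<And>r s. r < k \<Longrightarrow> s < k \<Longrightarrow> M r s \<in> polyfun m d"
  shows "(\<lambda>x. det (mat k k (\<lambda>(r, s). M r s x))) \<in> polyfun m (k * d)"
proof -
  have "(\<lambda>x. \<Sum>\<sigma> | \<sigma> permutes {0..<k}. signof \<sigma> * (\<Prod>r = 0..<k. M r (\<sigma> r) x)) \<in> polyfun m (k * d)"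
  proof (intro polyfun_sum polyfun_scale)
    fix \<sigma> assume "\<sigma> \<in> {\<sigma>. \<sigma> permutes {0..<k}}"
    then have "(\<lambda>x. \<Prod>r = 0..<k. M r (\<sigma> r) x) \<in> polyfun m (card {0..<k} * d)"
      using assms permutes_in_image by (intro polyfun_prod) fastforce
    then show "(\<lambda>x. \<Prod>r = 0..<k. M r (\<sigma> r) x) \<in> polyfun m (k * d)" by simp
  qed
  moreover have "det (mat k k (\<lambda>(r, s). M r s x))
      = (\<Sum>\<sigma> | \<sigma> permutes {0..<k}. signof \<sigma> * (\<Prod>r = 0..<k. M r (\<sigma> r) x))" for x
    by (subst det_def'[of _ k])
       (auto intro!: sum.cong prod.cong dest: permutes_in_image)
  ultimately show ?thesis by simp
qed

lemma dval_monom_polyfun: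
  assumes "i < m" "l \<le> n"
  shows "(\<lambda>x. dval j (x i) (monom 1 l)) \<in> polyfun m n"
proof (cases "j \<le> l")
  case True
  have "(\<lambda>x. dval j (x i) (monom 1 l)) = (\<lambda>x. coeff ((pderiv ^^ j) (monom 1 l)) (l - j) * x i ^ (l - j))"
  proof -
    have "(pderiv ^^ j) (monom 1 l) = monom (coeff ((pderiv ^^ j) (monom (1::complex) l)) (l - j)) (l - j)"
      using True by (intro poly_eqI) (auto simp: coeff_higher_pderiv)
    then show ?thesis unfolding dval_def by (metis poly_monom)
  qed
  then show ?thesis using assms by (simp add: polyfun_power)
next
  case False
  then have "dval j y (monom 1 l) = 0" for y by (intro dval_eq_0) (simp add: degree_monom_eq)
  then show ?thesis by (simp add: polyfun_0)
qed

section \<open>Patterns that share a basis\<close>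

text \<open>
  The determinant is that of the linear map \<open>p \<mapsto> (\<phi> 0 p, \<dots>, \<phi> n p)\<close> in the monomial basis.
\<close>

lemma det_functionals_eq_0_iff:
  assumes f: "\<And>r. r \<le> n \<Longrightarrow> functional (\<phi> r)"
  shows "det (mat (n + 1) (n + 1) (\<lambda>(r, l). \<phi> r (monom 1 l))) = 0 \<longleftrightarrow>
    (\<exists>p. p \<noteq> 0 \<and> degree p \<le> n \<and> (\<forall>r\<le>n. \<phi> r p = 0))"
proof -
  have \<phi>: "\<phi> r (\<Sum>l<n + 1. monom (a l) l) = (\<Sum>l<n + 1. \<phi> r (monom 1 l) * a l)" if "r \<le> n" for r a
  proof -
    have "monom (a l) l = smult (a l) (monom 1 l)" for l by (simp add: smult_monom)
    then show ?thesis using f[OF that] by (simp only: functionalD mult.commute)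
  qed
  have coeff: "coeff (\<Sum>l<n + 1. monom (a l) l) k = (if k \<le> n then a k else 0)" for a :: "nat \<Rightarrow> complex" and k
    by (auto simp: coeff_sum sum.delta)
  show ?thesis unfolding det_mat_eq_0_iff
  proof safe
    fix a s assume a: "\<forall>r<n + 1. (\<Sum>l<n + 1. \<phi> r (monom 1 l) * a l) = 0" and s: "s < n + 1" "a s \<noteq> 0"
    show "\<exists>p. p \<noteq> 0 \<and> degree p \<le> n \<and> (\<forall>r\<le>n. \<phi> r p = 0)"
    proof (intro exI[of _ "\<Sum>l<n + 1. monom (a l) l"] conjI allI impI)
      show "(\<Sum>l<n + 1. monom (a l) l) \<noteq> 0"
      proof
        assume "(\<Sum>l<n + 1. monom (a l) l) = 0"
        then have "coeff (\<Sum>l<n + 1. monom (a l) l) s = 0" by simp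
        then show False using s unfolding coeff by simp
      qed
      show "degree (\<Sum>l<n + 1. monom (a l) l) \<le> n"
        by (intro degree_le allI impI) (simp only: coeff, simp)
      show "\<phi> r (\<Sum>l<n + 1. monom (a l) l) = 0" if "r \<le> n" for r
        using \<phi>[OF that, of a] a that by simp
    qed
  next
    fix p assume p: "p \<noteq> 0" "degree p \<le> n" "\<forall>r\<le>n. \<phi> r p = 0"
    have eq: "p = (\<Sum>l<n + 1. monom (coeff p l) l)"
      by (rule poly_eqI) (use p(2) in \<open>simp only: coeff, simp add: coeff_eq_0\<close>)
    show "\<exists>a. (\<exists>s<n + 1. a s \<noteq> 0) \<and> (\<forall>r<n + 1. (\<Sum>l<n + 1. \<phi> r (monom 1 l) * a l) = 0)"
    proof (intro exI[of _ "coeff p"] conjI allI impI)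
      show "\<exists>s<n + 1. coeff p s \<noteq> 0" using p by (intro exI[of _ "degree p"]) auto
      show "(\<Sum>l<n + 1. \<phi> r (monom 1 l) * coeff p l) = 0" if "r < n + 1" for r
        using \<phi>[of r "coeff p"] p(3) that eq by simp
    qed
  qed
qed

text \<open>
  A condition is kept only if it shrinks the solution space, and then it lowers the dimension by exactly
  one.
\<close>

lemma exists_basis:
  assumes "finite Z"
  shows "\<exists>B\<subseteq>Z. vanish n x B = vanish n x Z \<and> card B + card (degs (vanish n x B)) = n + 1"
  using assms
proof (induction Z)
  case empty
  then show ?case by (simp add: vanish_def degs_degree_le)
next
  case (insert z Z)
  then obtain B where B: "B \<subseteq> Z" "vanish n x B = vanish n x Z" "card B + card (degs (vanish n x B)) = n + 1"
    by blast
  have eq: "vanish n x (insert z B) = vanish n x (insert z Z)" using B(2) by (simp add: vanish_insert)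
  show ?case
  proof (cases "vanish n x (insert z B) = vanish n x B")
    case True
    then show ?thesis using B eq by (intro exI[of _ B]) auto
  next
    case False
    have finB: "finite B" using B(1) insert.hyps finite_subset by blast
    have "vanish n x (insert z B) \<subset> vanish n x B" using False by (auto simp: vanish_insert)
    then have "card (degs (vanish n x (insert z B))) < card (degs (vanish n x B))"
      by (intro card_degs_psubset subspace_vanish finite_degs_vanish)
    moreover have "n + 1 \<le> card (degs (vanish n x (insert z B))) + card (insert z B)"
      using finB by (intro card_degs_vanish) simp
    moreover have "card (insert z B) = card B + 1" using B(1) insert.hyps(2) finB
      by (subst card_insert_disjoint) auto
    ultimately have "card (insert z B) + card (degs (vanish n x (insert z B))) = n + 1"
      using B(3) by simp
    then show ?thesis using eq B(1) by (intro exI[of _ "insert z B"]) auto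
  qed
qed

text \<open>
  Each nonzero space contains a nonzero polynomial, so vanishing at a point that avoids the finitely many
  roots of these polynomials lowers the dimension of all nonzero spaces at once.
\<close>

lemma generic_evaluations:
  assumes "finite \<W>"
    and "\<And>W. W \<in> \<W> \<Longrightarrow> poly_space.subspace W \<and> finite (degs W) \<and> card (degs W) \<le> d"
  shows "\<exists>t::nat \<Rightarrow> complex. \<forall>W\<in>\<W>. {p \<in> W. \<forall>s<d. poly p (t s) = 0} = {0}"
  using assms
proof (induction d arbitrary: \<W>)
  case 0
  have "{p \<in> W. \<forall>s<0. poly p 0 = 0} = {0}" if "W \<in> \<W>" for W
    using 0(2)[OF that] degs_empty_iff[of W] card_0_eq[of "degs W"] by (cases "W = {0}") auto
  then show ?case by (intro exI[of _ "\<lambda>_. 0"] ballI)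
next
  case (Suc d)
  have "\<exists>p. W \<noteq> {0} \<longrightarrow> p \<in> W \<and> p \<noteq> 0" if "W \<in> \<W>" for W
  proof (cases "W = {0}")
    case False
    moreover have "0 \<in> W" using Suc.prems(2)[OF that] poly_space.subspace_0 by blast
    ultimately show ?thesis by blast
  qed simp
  then have "\<exists>p. \<forall>W\<in>\<W>. W \<noteq> {0} \<longrightarrow> p W \<in> W \<and> p W \<noteq> 0" by (intro bchoice ballI)
  then obtain p where p: "\<And>W. W \<in> \<W> \<Longrightarrow> W \<noteq> {0} \<Longrightarrow> p W \<in> W \<and> p W \<noteq> 0" by blast
  have "finite (\<Union>W\<in>\<W> - {{0}}. {y. poly (p W) y = 0})"
    using Suc.prems(1) p by (intro finite_UN_I poly_roots_finite) simp_all
  then obtain y where y: "y \<notin> (\<Union>W\<in>\<W> - {{0}}. {y. poly (p W) y = 0})"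
    using ex_new_if_finite[OF infinite_UNIV_char_0] by blast
  define cut where "cut W = {q \<in> W. poly q y = 0}" for W
  have "\<exists>t::nat \<Rightarrow> complex. \<forall>W\<in>cut ` \<W>. {p \<in> W. \<forall>s<d. poly p (t s) = 0} = {0}"
  proof (rule Suc.IH)
    fix W' assume "W' \<in> cut ` \<W>"
    then obtain W where W: "W \<in> \<W>" "W' = cut W" by auto
    note sW = Suc.prems(2)[OF W(1)]
    have sub: "poly_space.subspace (cut W)" unfolding cut_def
      using subspace_kernel[of W UNIV "\<lambda>_ q. poly q y"] sW functional_poly by simp
    have fin: "finite (degs (cut W))"
      using sW by (intro finite_subset[OF degs_mono[of "cut W" W]]) (auto simp: cut_def)
    have "card (degs (cut W)) \<le> d"
    proof (cases "W = {0}")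
      case True
      then have "cut W = {0}" by (auto simp: cut_def)
      then show ?thesis by (simp add: degs_def)
    next
      case False
      then have "poly (p W) y \<noteq> 0" using y W(1) by auto
      then have "p W \<in> W - cut W" using p[OF W(1) False] by (simp add: cut_def)
      moreover have "cut W \<subseteq> W" by (auto simp: cut_def)
      ultimately have "cut W \<subset> W" by blast
      then have "card (degs (cut W)) < card (degs W)"
        using sW by (intro card_degs_psubset sub) auto
      then show ?thesis using sW by simp
    qed
    then show "poly_space.subspace W' \<and> finite (degs W') \<and> card (degs W') \<le> d"
      using sub fin W by simp
  qed (use Suc.prems in simp)
  then obtain t :: "nat \<Rightarrow> complex"
    where t0: "\<forall>W\<in>cut ` \<W>. {p \<in> W. \<forall>s<d. poly p (t s) = 0} = {0}" ..
  have t: "{p \<in> cut W. \<forall>s<d. poly p (t s) = 0} = {0}" if "W \<in> \<W>" for W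
    using bspec[OF t0 imageI[OF that]] .
  have "{p \<in> W. \<forall>s<Suc d. poly p (case_nat y t s) = 0} = {p \<in> cut W. \<forall>s<d. poly p (t s) = 0}" for W
    unfolding cut_def All_less_Suc2 by auto
  then show ?case using t by (intro exI[of _ "case_nat y t"] ballI) (simp only:)
qed

text \<open>
  With \<open>k = card B\<close>, adjoin \<open>n - k\<close> generic evaluations to the conditions in \<open>B\<close>.
  At the nodes of each pattern \<open>Z\<close> a nonzero polynomial solves these \<open>n\<close> conditions,
  and it satisfies a further condition \<open>f\<close> if and only if \<open>f \<in> Z\<close>. So \<open>f \<in> Z\<close> is the
  vanishing of the determinant \<open>D f\<close> of the \<open>n + 1\<close> functionals, a polynomial function of the nodes,
  and \<open>card_zero_patterns_le\<close> applies.
\<close>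

lemma card_patterns_with_basis:
  fixes x :: "(nat \<times> nat) set \<Rightarrow> nat \<Rightarrow> complex"
  assumes sub: "\<And>Z. Z \<in> \<Z> \<Longrightarrow> Z \<subseteq> {..<m} \<times> {..n}"
    and P: "\<And>Z. Z \<in> \<Z> \<Longrightarrow> P Z \<in> vanish n (x Z) Z \<and> P Z \<noteq> 0 \<and>
      (\<forall>f\<in>{..<m} \<times> {..n} - Z. dval (snd f) (x Z (fst f)) (P Z) \<noteq> 0)"
    and B: "\<And>Z. Z \<in> \<Z> \<Longrightarrow> B \<subseteq> Z \<and> vanish n (x Z) B = vanish n (x Z) Z \<and>
      card B + card (degs (vanish n (x Z) B)) = n + 1"
  shows "card \<Z> \<le> (m * (n + 1) * ((n + 1) * n) + 1) ^ m"
proof (cases "\<Z> = {}")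
  case False
  define F where "F = {..<m} \<times> {..n}"
  have finF: "finite F" by (simp add: F_def)
  have fin: "finite \<Z>" by (rule finite_subset[of _ "Pow F"]) (use sub finF in \<open>auto simp: F_def\<close>)
  obtain Z0 where Z0: "Z0 \<in> \<Z>" using False by blast
  have BF: "B \<subseteq> F" using conjunct1[OF B[OF Z0]] sub[OF Z0] by (auto simp: F_def)
  have finB: "finite B" using BF finF finite_subset by blast
  have nonzero: "1 \<le> card (degs (vanish n (x Z) B))" if "Z \<in> \<Z>" for Z
  proof -
    have "degree (P Z) \<in> degs (vanish n (x Z) B)" using P[OF that] conjunct1[OF conjunct2[OF B[OF that]]] by (auto simp: degs_def)
    then have "degs (vanish n (x Z) B) \<noteq> {}" by blast
    then show ?thesis using finite_degs_vanish[of n "x Z" B] by (simp add: Suc_le_eq card_gt_0_iff)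
  qed
  have cardB: "card B + card (degs (vanish n (x Z) B)) = n + 1" if "Z \<in> \<Z>" for Z
    using B[OF that] by blast
  define k where "k = card B"
  have k: "k \<le> n" using cardB[OF Z0] nonzero[OF Z0] by (simp add: k_def)
  \<comment> \<open>The spaces that the evaluations have to reduce to zero.\<close>
  define \<W> where "\<W> = (\<lambda>(Z, f). vanish n (x Z) (insert f B)) ` (SIGMA Z:\<Z>. F - Z)"
  have "\<exists>t::nat \<Rightarrow> complex. \<forall>W\<in>\<W>. {p \<in> W. \<forall>s<n - k. poly p (t s) = 0} = {0}"
  proof (rule generic_evaluations)
    show "finite \<W>" unfolding \<W>_def using fin finF by (intro finite_imageI finite_SigmaI) auto
    fix W assume "W \<in> \<W>"
    then obtain Z f where Zf: "Z \<in> \<Z>" "f \<in> F - Z" "W = vanish n (x Z) (insert f B)" by (auto simp: \<W>_def)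
    have "P Z \<in> vanish n (x Z) B" "P Z \<notin> W"
      using P[OF Zf(1)] conjunct1[OF conjunct2[OF B[OF Zf(1)]]] Zf(2)
      unfolding Zf(3) vanish_insert F_def by simp_all
    then have "W \<subset> vanish n (x Z) B" unfolding Zf(3) vanish_insert by blast
    then have "card (degs W) < card (degs (vanish n (x Z) B))"
      unfolding Zf(3) by (intro card_degs_psubset subspace_vanish finite_degs_vanish)
    then show "poly_space.subspace W \<and> finite (degs W) \<and> card (degs W) \<le> n - k"
      using cardB[OF Zf(1)] unfolding Zf(3) k_def by (simp add: subspace_vanish finite_degs_vanish)
  qed
  then obtain t :: "nat \<Rightarrow> complex"
    where t0: "\<forall>W\<in>\<W>. {p \<in> W. \<forall>s<n - k. poly p (t s) = 0} = {0}" ..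
  have t: "{p \<in> vanish n (x Z) (insert f B). \<forall>s<n - k. poly p (t s) = 0} = {0}"
    if "Z \<in> \<Z>" "f \<in> F - Z" for Z f
  proof (rule bspec[OF t0])
    show "vanish n (x Z) (insert f B) \<in> \<W>"
      unfolding \<W>_def using that by (intro image_eqI[of _ _ "(Z, f)"]) auto
  qed
  obtain b where b: "bij_betw b {..<k} B"
    using ex_bij_betw_nat_finite[OF finB] by (auto simp: k_def atLeast0LessThan)
  define \<phi> where "\<phi> f y r p = (if r < k then dval (snd (b r)) (y (fst (b r))) p
      else if r < n then poly p (t (r - k)) else dval (snd f) (y (fst f)) p)" for f y r p
  define D where "D f y = det (mat (n + 1) (n + 1) (\<lambda>(r, l). \<phi> f y r (monom 1 l)))" for f y
  have \<phi>: "functional (\<phi> f y r)" for f y r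
    unfolding \<phi>_def by (cases "r < k"; cases "r < n") (simp_all add: functional_dval functional_poly)
  have rows: "(\<forall>r\<le>n. \<phi> f y r p = 0) \<longleftrightarrow> (\<forall>a\<in>insert f B. dval (snd a) (y (fst a)) p = 0) \<and>
      (\<forall>s<n - k. poly p (t s) = 0)" for f y p
  proof -
    have "{..n} = {..<k} \<union> {k..<n} \<union> {n}" using k by auto
    moreover have "(\<forall>r\<le>n. \<phi> f y r p = 0) \<longleftrightarrow> (\<forall>r\<in>{..n}. \<phi> f y r p = 0)" unfolding Ball_def atMost_iff ..
    ultimately have "(\<forall>r\<le>n. \<phi> f y r p = 0) \<longleftrightarrow> (\<forall>r\<in>{..<k} \<union> {k..<n} \<union> {n}. \<phi> f y r p = 0)"
      by (simp only:)
    also have "\<dots> \<longleftrightarrow> (\<forall>r\<in>{..<k}. dval (snd (b r)) (y (fst (b r))) p = 0) \<and>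
        (\<forall>r\<in>{k..<n}. poly p (t (r - k)) = 0) \<and> dval (snd f) (y (fst f)) p = 0"
      using k by (auto simp: \<phi>_def)
    also have "(\<forall>r\<in>{..<k}. dval (snd (b r)) (y (fst (b r))) p = 0) \<longleftrightarrow>
        (\<forall>a\<in>B. dval (snd a) (y (fst a)) p = 0)"
      using bij_betw_imp_surj_on[OF b] by auto
    also have "(\<forall>r\<in>{k..<n}. poly p (t (r - k)) = 0) \<longleftrightarrow> (\<forall>s<n - k. poly p (t s) = 0)"
    proof safe
      fix s assume all: "\<forall>r\<in>{k..<n}. poly p (t (r - k)) = 0" and "s < n - k"
      then have "k + s \<in> {k..<n}" by simp
      with all have "poly p (t (k + s - k)) = 0" by (rule bspec)
      then show "poly p (t s) = 0" by simp
    next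
      fix r assume "\<forall>s<n - k. poly p (t s) = 0" "r \<in> {k..<n}"
      then show "poly p (t (r - k)) = 0" by auto
    qed
    finally show ?thesis by auto
  qed
  have D0: "D f y = 0 \<longleftrightarrow> (\<exists>p. p \<noteq> 0 \<and> p \<in> vanish n y (insert f B) \<and> (\<forall>s<n - k. poly p (t s) = 0))" for f y
    unfolding D_def det_functionals_eq_0_iff[OF \<phi>] rows by (auto simp: vanish_def)
  have "card \<Z> \<le> card (monomials m (m * (n + 1) * ((n + 1) * n)))"
  proof (rule card_zero_patterns_le[OF fin finF, of D x])
    show "Z \<subseteq> F" if "Z \<in> \<Z>" for Z using sub[OF that] by (simp add: F_def)
    show "D f (x Z) = 0 \<longleftrightarrow> f \<in> Z" if Z: "Z \<in> \<Z>" and f: "f \<in> F" for Z f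
    proof
      assume "D f (x Z) = 0"
      show "f \<in> Z"
      proof (rule ccontr)
        assume "f \<notin> Z"
        then have "{p \<in> vanish n (x Z) (insert f B). \<forall>s<n - k. poly p (t s) = 0} = {0}"
          using t[OF Z] f by simp
        moreover obtain p where "p \<noteq> 0" "p \<in> vanish n (x Z) (insert f B)" "\<forall>s<n - k. poly p (t s) = 0"
          using \<open>D f (x Z) = 0\<close> unfolding D0 by auto
        then have "p \<in> {p \<in> vanish n (x Z) (insert f B). \<forall>s<n - k. poly p (t s) = 0}" by simp
        ultimately show False using \<open>p \<noteq> 0\<close> by simp
      qed
    next
      assume "f \<in> Z"
      define U where "U = {p \<in> vanish n (x Z) B. \<forall>s\<in>{..<n - k}. poly p (t s) = 0}"
      have "card (degs (vanish n (x Z) B)) \<le> card (degs U) + card {..<n - k}"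
        unfolding U_def by (intro card_degs_kernel subspace_vanish finite_degs_vanish functional_poly) auto
      then have "1 \<le> card (degs U)" using cardB[OF Z] k by (simp add: k_def)
      then have "degs U \<noteq> {}" by auto
      then obtain p where p: "p \<in> U" "p \<noteq> 0" by (auto simp: degs_def)
      have "p \<in> vanish n (x Z) Z" using p B[OF Z] by (simp add: U_def)
      then have "p \<in> vanish n (x Z) (insert f B)" using \<open>f \<in> Z\<close> conjunct1[OF B[OF Z]] by (auto simp: vanish_def)
      then show "D f (x Z) = 0" unfolding D0 using p by (auto simp: U_def)
    qed
    show "(\<lambda>y. \<Prod>f\<in>F - Z. D f y) \<in> polyfun m (m * (n + 1) * ((n + 1) * n))" if "Z \<in> \<Z>" for Z
    proof -
      have "D f \<in> polyfun m ((n + 1) * n)" if f: "f \<in> F" for f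
        unfolding D_def[abs_def]
      proof (rule polyfun_det)
        fix r l assume "r < n + 1" "l < n + 1"
        moreover have "fst (b r) < m" if "r < k"
        proof -
          have "b r \<in> F" using bij_betwE[OF b] that BF by auto
          then show ?thesis by (auto simp: F_def)
        qed
        moreover have "fst f < m" using f by (auto simp: F_def)
        ultimately show "(\<lambda>y. \<phi> f y r (monom 1 l)) \<in> polyfun m n"
          by (cases "r < k"; cases "r < n") (simp_all add: \<phi>_def dval_monom_polyfun polyfun_const)
      qed
      then have "(\<lambda>y. \<Prod>f\<in>F - Z. D f y) \<in> polyfun m (card (F - Z) * ((n + 1) * n))"
        by (intro polyfun_prod) auto
      moreover have "card (F - Z) \<le> m * (n + 1)"
        using card_mono[OF finF, of "F - Z"] by (simp add: F_def card_cartesian_product)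
      then have "polyfun m (card (F - Z) * ((n + 1) * n)) \<subseteq> polyfun m (m * (n + 1) * ((n + 1) * n))"
        by (intro polyfun_mono mult_le_mono1)
      ultimately show ?thesis by blast
    qed
  qed (rule finite_monomials)
  also have "\<dots> \<le> (m * (n + 1) * ((n + 1) * n) + 1) ^ m" by (rule card_monomials)
  finally show ?thesis .
qed simp

section \<open>The upper bound and the asymptotics\<close>

lemma dval_degree_nonzero:
  assumes "P \<noteq> 0"
  shows "dval (degree P) y P \<noteq> 0"
proof -
  have "degree ((pderiv ^^ degree P) P) = 0" by (simp add: degree_higher_pderiv)
  then have c: "(pderiv ^^ degree P) P = [:coeff ((pderiv ^^ degree P) P) 0:]" by (rule degree_0_id[symmetric])
  have "dval (degree P) y P = coeff ((pderiv ^^ degree P) P) 0"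
    unfolding dval_def by (subst c) simp
  also have "\<dots> \<noteq> 0" using assms by (simp add: coeff_higher_pderiv flip: pochhammer_fact)
  finally show ?thesis .
qed

text \<open>
  Patterns are grouped by a chosen basis. A basis has at most \<open>n\<close> elements and avoids column \<open>n\<close>, because
  the \<open>n\<close>-th derivative of a polynomial of degree \<open>n\<close> is a nonzero constant; and
  \<open>k \<mapsto> mn choose k\<close> increases up to \<open>k = n\<close> as \<open>2 n \<le> m n\<close>.
\<close>

lemma card_patterns_upper:
  assumes m: "2 \<le> m"
  shows "card (patterns m n) \<le> (n + 1) * (m * n choose n) * (m * (n + 1) * ((n + 1) * n) + 1) ^ m"
    (is "_ \<le> _ * ?K")
proof -
  define grid where "grid = {..<m} \<times> {..<n}"
  have "\<forall>Z\<in>patterns m n. \<exists>w. Z \<subseteq> grid \<and>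
      (fst (snd w) \<in> vanish n (fst w) Z \<and> fst (snd w) \<noteq> 0 \<and>
        (\<forall>f\<in>{..<m} \<times> {..n} - Z. dval (snd f) (fst w (fst f)) (fst (snd w)) \<noteq> 0)) \<and>
      (snd (snd w) \<subseteq> Z \<and> vanish n (fst w) (snd (snd w)) = vanish n (fst w) Z \<and>
        card (snd (snd w)) + card (degs (vanish n (fst w) (snd (snd w)))) = n + 1)"
  proof
    fix Z assume "Z \<in> patterns m n"
    then obtain x P where P: "P \<noteq> 0" "degree P = n"
      and Z: "Z = {(i, j). i < m \<and> j \<le> n \<and> dval j (x i) P = 0}"
      unfolding patterns_def by blast
    have "j \<noteq> n" if "dval j (x i) P = 0" for i j
      using dval_degree_nonzero[OF P(1)] P(2) that by auto
    then have sub: "Z \<subseteq> grid" unfolding Z grid_def by (auto simp: le_less)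
    have "finite Z" by (rule finite_subset[OF sub]) (simp add: grid_def)
    then obtain B where B: "B \<subseteq> Z \<and> vanish n x B = vanish n x Z \<and> card B + card (degs (vanish n x B)) = n + 1"
      using exists_basis[of Z n x] by blast
    have P1: "P \<in> vanish n x Z" using P Z by (auto simp: vanish_def)
    have P2: "\<forall>f\<in>{..<m} \<times> {..n} - Z. dval (snd f) (x (fst f)) P \<noteq> 0" using Z by auto
    show "\<exists>w. Z \<subseteq> grid \<and>
      (fst (snd w) \<in> vanish n (fst w) Z \<and> fst (snd w) \<noteq> 0 \<and>
        (\<forall>f\<in>{..<m} \<times> {..n} - Z. dval (snd f) (fst w (fst f)) (fst (snd w)) \<noteq> 0)) \<and>
      (snd (snd w) \<subseteq> Z \<and> vanish n (fst w) (snd (snd w)) = vanish n (fst w) Z \<and>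
        card (snd (snd w)) + card (degs (vanish n (fst w) (snd (snd w)))) = n + 1)"
      by (rule exI[of _ "(x, P, B)"], unfold fst_conv snd_conv)
         (rule conjI[OF sub conjI[OF conjI[OF P1 conjI[OF P(1) P2]] B]])
  qed
  from bchoice[OF this] obtain w where w: "\<forall>Z\<in>patterns m n. Z \<subseteq> grid \<and>
      (fst (snd (w Z)) \<in> vanish n (fst (w Z)) Z \<and> fst (snd (w Z)) \<noteq> 0 \<and>
        (\<forall>f\<in>{..<m} \<times> {..n} - Z. dval (snd f) (fst (w Z) (fst f)) (fst (snd (w Z))) \<noteq> 0)) \<and>
      (snd (snd (w Z)) \<subseteq> Z \<and> vanish n (fst (w Z)) (snd (snd (w Z))) = vanish n (fst (w Z)) Z \<and>
        card (snd (snd (w Z))) + card (degs (vanish n (fst (w Z)) (snd (snd (w Z))))) = n + 1)" ..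
  define basis where "basis Z = snd (snd (w Z))" for Z
  define \<B> where "\<B> = {B. B \<subseteq> grid \<and> card B \<le> n}"
  have fin\<B>: "finite \<B>" by (rule finite_subset[of _ "Pow grid"]) (auto simp: \<B>_def grid_def)
  have basis: "basis Z \<in> \<B>" if Z: "Z \<in> patterns m n" for Z
  proof -
    note wZ = bspec[OF w Z]
    have "degree (fst (snd (w Z))) \<in> degs (vanish n (fst (w Z)) (basis Z))"
      using wZ by (simp add: degs_def basis_def)
    then have "card (degs (vanish n (fst (w Z)) (basis Z))) \<noteq> 0"
      using finite_degs_vanish by auto
    then show ?thesis using wZ by (auto simp: \<B>_def basis_def)
  qed
  have fibre: "card {Z \<in> patterns m n. basis Z = B} \<le> ?K" for B
  proof (rule card_patterns_with_basis[where x = "\<lambda>Z. fst (w Z)" and P = "\<lambda>Z. fst (snd (w Z))" and B = B])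
    fix Z assume Z: "Z \<in> {Z \<in> patterns m n. basis Z = B}"
    then have Z': "Z \<in> patterns m n" and B: "snd (snd (w Z)) = B" by (auto simp: basis_def)
    note wZ = bspec[OF w Z', unfolded B]
    show "Z \<subseteq> {..<m} \<times> {..n}" using conjunct1[OF wZ] by (auto simp: grid_def)
    show "fst (snd (w Z)) \<in> vanish n (fst (w Z)) Z \<and> fst (snd (w Z)) \<noteq> 0 \<and>
        (\<forall>f\<in>{..<m} \<times> {..n} - Z. dval (snd f) (fst (w Z) (fst f)) (fst (snd (w Z))) \<noteq> 0)"
      by (rule conjunct1[OF conjunct2[OF wZ]])
    show "B \<subseteq> Z \<and> vanish n (fst (w Z)) B = vanish n (fst (w Z)) Z \<and>
        card B + card (degs (vanish n (fst (w Z)) B)) = n + 1"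
      by (rule conjunct2[OF conjunct2[OF wZ]])
  qed
  have "patterns m n = (\<Union>B\<in>\<B>. {Z \<in> patterns m n. basis Z = B})" using basis by auto
  then have "card (patterns m n) \<le> (\<Sum>B\<in>\<B>. card {Z \<in> patterns m n. basis Z = B})"
    using card_UN_le[OF fin\<B>, of "\<lambda>B. {Z \<in> patterns m n. basis Z = B}"] by simp
  also have "\<dots> \<le> card \<B> * ?K" using sum_bounded_above[of \<B>, OF fibre] by simp
  also have "card \<B> \<le> (n + 1) * (m * n choose n)"
  proof -
    have "\<B> = (\<Union>k\<le>n. {B. B \<subseteq> grid \<and> card B = k})" by (auto simp: \<B>_def)
    then have "card \<B> \<le> (\<Sum>k\<le>n. card {B. B \<subseteq> grid \<and> card B = k})"
      using card_UN_le[of "{..n}" "\<lambda>k. {B. B \<subseteq> grid \<and> card B = k}"] by simp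
    also have "\<dots> = (\<Sum>k\<le>n. m * n choose k)"
      by (intro sum.cong refl) (simp add: n_subsets grid_def card_cartesian_product)
    also have "\<dots> \<le> (\<Sum>k\<le>n. m * n choose n)" using m by (intro sum_mono binomial_mono) auto
    finally show ?thesis by simp
  qed
  finally show ?thesis by simp
qed

text \<open>
  Both bounds differ from \<open>ln (mn choose n) \<ge> n ln m\<close> by \<open>O(m ln n)\<close>. In terms of \<open>r = m / n\<close> the
  quotient \<open>m ln n / (n ln m)\<close> equals \<open>r (1 + ln (1 / r) / ln m)\<close>, which is small
  uniformly in \<open>m \<ge> 2\<close> when \<open>r\<close> is small.
\<close>

lemma entropy_ratio_bound:
  fixes m n :: nat
  assumes m: "2 \<le> m" and mn: "m \<le> n"
  defines "r \<equiv> real m / real n" and "L \<equiv> ln (real (m * n choose n))"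
  shows "0 < L" "\<bar>ln (real (card (dope_matrices m n))) / L - 1\<bar> \<le> 8 * r * (1 + ln (1 / r) / ln 2)"
proof -
  define C where "C = real (m * n choose n)"
  define c where "c = real (card (dope_matrices m n))"
  have n: "2 \<le> n" using m mn by simp
  have lnm: "ln 2 \<le> ln (real m)" "0 < ln (real m)" using m by auto
  have lnn: "0 < ln (real n)" using n by auto
  have "real m ^ n \<le> C"
    using binomial_ge_n_over_k_pow_k[of n "m * n", where ?'a = real] m n unfolding C_def by simp
  moreover have mn0: "0 < real m ^ n" using m by simp
  ultimately have C: "0 < C" by linarith
  have "ln (real m ^ n) \<le> ln C" using \<open>real m ^ n \<le> C\<close> mn0 C by (subst ln_le_cancel_iff)
  then have L: "real n * ln (real m) \<le> L" using m by (simp add: L_def C_def ln_realpow)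
  have "0 < real n * ln (real m)" using n lnm by simp
  then show L0: "0 < L" using L by linarith
  have "m * n choose n \<le> n * card (dope_matrices m n)"
    unfolding card_dope_matrices using m n by (intro card_patterns_lower) auto
  then have low: "C \<le> real n * c" unfolding C_def c_def of_nat_mult[symmetric] by (rule of_nat_mono)
  have c: "0 < c"
  proof (rule ccontr)
    assume "\<not> 0 < c"
    then have "c = 0" by (simp add: c_def)
    then show False using low C by simp
  qed
  have "ln C \<le> ln (real n * c)" using low C c n by (subst ln_le_cancel_iff) simp_all
  then have lower: "L - ln (real n) \<le> ln c" using c n by (simp add: L_def C_def ln_mult)
  define K where "K = real (m * (n + 1) * ((n + 1) * n) + 1)"
  have "card (dope_matrices m n) \<le> (n + 1) * (m * n choose n) * (m * (n + 1) * ((n + 1) * n) + 1) ^ m"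
    unfolding card_dope_matrices by (rule card_patterns_upper[OF m])
  then have "c \<le> real ((n + 1) * (m * n choose n) * (m * (n + 1) * ((n + 1) * n) + 1) ^ m)"
    unfolding c_def by (rule of_nat_mono)
  then have "c \<le> real (n + 1) * C * K ^ m" unfolding C_def K_def by (simp only: of_nat_mult of_nat_power)
  moreover have K: "0 < K" "K \<le> real n ^ 7"
  proof -
    have "m * (n + 1) * ((n + 1) * n) + 1 \<le> n * (2 * n) * ((2 * n) * n) + n ^ 4"
      using mn n by (intro add_mono mult_mono) auto
    also have "\<dots> = 5 * n ^ 4" by (simp add: power4_eq_xxxx)
    also have "\<dots> \<le> n ^ 3 * n ^ 4" using power_mono[OF n, of 3] by (intro mult_right_mono) auto
    finally have "m * (n + 1) * ((n + 1) * n) + 1 \<le> n ^ 7" by (simp flip: power_add)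
    then have "real (m * (n + 1) * ((n + 1) * n) + 1) \<le> real (n ^ 7)" by (rule of_nat_mono)
    then show "K \<le> real n ^ 7" by (simp add: K_def)
    have "0 < m * (n + 1) * ((n + 1) * n) + 1" by simp
    then show "0 < K" by (simp only: K_def of_nat_0_less_iff)
  qed
  ultimately have "ln c \<le> ln (real (n + 1) * C * K ^ m)" using c C by (subst ln_le_cancel_iff) auto
  also have "\<dots> = ln (real (n + 1)) + ln C + real m * ln K"
    using C K by (simp add: ln_mult ln_realpow)
  also have "ln C = L" by (simp add: L_def C_def)
  also have "ln K \<le> ln (real n ^ 7)" using K n by (subst ln_le_cancel_iff) auto
  then have "real m * ln K \<le> real m * (7 * ln (real n))"
    using n by (intro mult_left_mono) (auto simp: ln_realpow)
  also have "ln (real (n + 1)) \<le> real m * ln (real n)"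
  proof -
    have "2 * n \<le> n * n" using n by simp
    then have "n + 1 \<le> n ^ 2" using n by (simp only: power2_eq_square)
    then have "real (n + 1) \<le> real (n ^ 2)" by (rule of_nat_mono)
    then have "real (n + 1) \<le> real n ^ 2" by (simp only: of_nat_power)
    then have "ln (real (n + 1)) \<le> ln (real n ^ 2)" using n by (subst ln_le_cancel_iff) auto
    also have "\<dots> = 2 * ln (real n)" using n by (simp add: ln_realpow)
    also have "\<dots> \<le> real m * ln (real n)" using m lnn by (intro mult_right_mono) auto
    finally show ?thesis .
  qed
  finally have upper: "ln c - L \<le> 8 * real m * ln (real n)" by simp
  have "1 * ln (real n) \<le> 8 * real m * ln (real n)" using m lnn by (intro mult_right_mono) auto
  then have abs: "\<bar>ln c - L\<bar> \<le> 8 * real m * ln (real n)" using upper lower by linarith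
  have r: "0 < r" "r \<le> 1" using m mn n by (auto simp: r_def)
  have "ln (real n) = ln (real m) + ln (1 / r)" using m n by (simp add: r_def ln_div)
  also have "\<dots> \<le> ln (real m) + ln (1 / r) / ln 2 * ln (real m)"
  proof -
    have "ln (1 / r) / ln 2 * ln 2 \<le> ln (1 / r) / ln 2 * ln (real m)"
      using r lnm by (intro mult_left_mono) auto
    then show ?thesis by simp
  qed
  finally have lnn': "ln (real n) \<le> (1 + ln (1 / r) / ln 2) * ln (real m)" by (simp add: algebra_simps)
  have "ln c / L - 1 = (ln c - L) / L" using L0 by (simp add: diff_divide_distrib)
  then have "\<bar>ln c / L - 1\<bar> = \<bar>ln c - L\<bar> / L" using L0 by (simp add: abs_divide)
  also have "\<dots> \<le> (8 * real m * ln (real n)) / L" using abs L0 by (intro divide_right_mono) auto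
  also have "\<dots> \<le> (8 * real m * ln (real n)) / (real n * ln (real m))"
    using L L0 lnn lnm n by (intro divide_left_mono mult_pos_pos) simp_all
  also have "\<dots> \<le> (8 * real m * ((1 + ln (1 / r) / ln 2) * ln (real m))) / (real n * ln (real m))"
    using lnn' lnm by (intro divide_right_mono mult_left_mono) auto
  also have "\<dots> = 8 * r * (1 + ln (1 / r) / ln 2)" using lnm n by (simp add: r_def)
  finally show "\<bar>ln (real (card (dope_matrices m n))) / L - 1\<bar> \<le> 8 * r * (1 + ln (1 / r) / ln 2)"
    by (simp add: c_def)
qed

theorem theorem3p1:
  fixes m n :: "nat \<Rightarrow> nat"
  assumes "\<And>t. t > 0 \<Longrightarrow> m t > 0"
    and "\<And>t. t > 0 \<Longrightarrow> n t > 0"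
    and "eventually (\<lambda>t. m t \<ge> 2) sequentially"
    and "filterlim n at_top sequentially"
    and "(\<lambda>t. real (m t)) \<in> o[sequentially](\<lambda>t. real (n t))"
  shows "\<exists>\<epsilon> :: nat \<Rightarrow> real. \<epsilon> \<in> o[sequentially](\<lambda>_. 1) \<and>
           eventually (\<lambda>t. ln (real (card (dope_matrices (m t) (n t))))
             = (1 + \<epsilon> t) * ln (real ((m t * n t) choose (n t)))) sequentially"
proof -
  define r where "r t = real (m t) / real (n t)" for t
  define L where "L t = ln (real (m t * n t choose n t))" for t
  define \<epsilon> where "\<epsilon> t = ln (real (card (dope_matrices (m t) (n t)))) / L t - 1" for t
  have r0: "r \<longlonglongrightarrow> 0" unfolding r_def using assms(5) by (rule smalloD_tendsto)
  have mn: "eventually (\<lambda>t. m t \<le> n t) sequentially"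
  proof -
    have "eventually (\<lambda>t. norm (real (m t)) \<le> 1 * norm (real (n t))) sequentially"
      by (rule landau_o.smallD[OF assms(5)]) simp
    then show ?thesis by simp
  qed
  have "eventually (\<lambda>t. 0 < r t) sequentially"
    using assms(3) mn by eventually_elim (auto simp: r_def)
  then have "filterlim r (at_right 0) sequentially"
    using r0 by (simp add: filterlim_at eventually_mono)
  moreover have "((\<lambda>r. 8 * r * (1 + ln (1 / r) / ln 2)) \<longlongrightarrow> (0 :: real)) (at_right 0)" by real_asymp
  ultimately have lim: "(\<lambda>t. 8 * r t * (1 + ln (1 / r t) / ln 2)) \<longlonglongrightarrow> 0"
    by (rule filterlim_compose[rotated])
  have bound: "eventually (\<lambda>t. norm (\<epsilon> t) \<le> 8 * r t * (1 + ln (1 / r t) / ln 2)) sequentially"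
    using assms(3) mn unfolding \<epsilon>_def L_def r_def real_norm_def
    by eventually_elim (rule entropy_ratio_bound(2))
  have "\<epsilon> \<longlonglongrightarrow> 0" 
    by (rule tendsto_0_le[OF lim, of _ 1]) (use bound in eventually_elim, simp)
  then have "\<epsilon> \<in> o[sequentially](\<lambda>_. 1)" by (intro smalloI_tendsto) auto
  moreover have "eventually (\<lambda>t. ln (real (card (dope_matrices (m t) (n t)))) = (1 + \<epsilon> t) * L t) sequentially"
    using assms(3) mn
  proof eventually_elim
    case (elim t)
    then have "L t \<noteq> 0" using entropy_ratio_bound(1)[of "m t" "n t"] by (simp add: L_def)
    then show ?case by (simp add: \<epsilon>_def)
  qed
  ultimately show ?thesis unfolding L_def by blast
qed

end
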